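(* Let $\ell\geq2$ and $M\geq\ell/2$, and suppose the indices $\alpha_1,\ldots,\alpha_\ell$ are all distinct and non-zero. The quadrature effort $\mathcal U$, measured in flops, required to approximate $J_{\alpha_1\cdots\alpha_\ell}(t_n,t_{n+1})$ (by its conditional expectation $\mathbb E(J_{\alpha_1\cdots\alpha_\ell}(t_n,t_{n+1})\,|\,\mathcal F_Q)$ on every step of $[0,T]$) with a global error of order $h^M$ is, to leading order in $h$, $$\mathcal U=\mathcal O\bigl(h^{-\beta(M,\ell)}\bigr),\qquad\text{where}\qquad \beta(M,\ell)=(\ell-1)(2M+1-\ell)+1.$$ Since the global error associated with the multiple integral approximation is stipulated to be $\mathcal E=\mathcal O(h^M)$, we have $$\mathcal E=\mathcal O\bigl(\mathcal U^{-M/\beta(M,\ell)}\bigr).$$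
   Context: $(W^1,\ldots,W^d)$ is a $d$-dimensional Wiener process and $W^0_t\equiv t$; indices lie in $\{0,1,\ldots,d\}$. The interval $[0,T]$ is divided into $N=Th^{-1}$ steps $[t_n,t_{n+1}]$, $t_n=nh$, each divided into $Q$ subintervals of length $\Delta t=h/Q$. $J_{\alpha_1\cdots\alpha_\ell}(t_n,t)$ is the multiple Stratonovich integral defined by $J_{\alpha_1}(t_n,t)=W^{\alpha_1}_t-W^{\alpha_1}_{t_n}$, $J_{\alpha_1\cdots\alpha_\ell}(t_n,t)=\int_{t_n}^tJ_{\alpha_1\cdots\alpha_{\ell-1}}(t_n,\tau)\,\mathrm{d}W^{\alpha_\ell}_\tau$. $\mathcal F_Q$ is the $\sigma$-algebra generated by all Wiener increments $W^i_{t_n+(q+1)\Delta t}-W^i_{t_n+q\Delta t}$, $i=1,\ldots,d$, $q=0,\ldots,Q-1$, $n=0,\ldots,N-1$. Cost model: for distinct non-zero indices, $\mathbb E(J_{\alpha_1\cdots\alpha_\ell}(t_n,t_{n+1})\,|\,\mathcal F_Q)$ is an $(\ell-1)$-multiple sum over the $Q$ sub-increments, so the quadrature effort of computing it on all $N$ steps of $[0,T]$ is $\mathcal U=\mathcal O(Q^{\ell-1}N)$ flops. Error convention: the local errors $J_{\alpha_1\cdots\alpha_\ell}(t_n,t_{n+1})-\mathbb E(J_{\alpha_1\cdots\alpha_\ell}(t_n,t_{n+1})\,|\,\mathcal F_Q)$ have zero expectation and accumulate over the $N$ steps in mean square, so a global error of order $h^M$ means that the local error has $L^2$-norm of order $h^{M+1/2}$;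 $Q=Q(h)$ is chosen of the order in $h$ required to achieve this, as dictated by the fact that, for distinct non-zero indices, the local $L^2$ error is of order $h^{\ell/2}/Q^{1/2}$. *)

theory Defs
  imports "HOL-Probability.Probability" "HOL-Library.Landau_Symbols"
begin

text \<open>
  A family \<open>W i t\<close> with \<open>W 0 t = t\<close>, in which \<open>W 1, \<dots>, W d\<close> are the components of a standard
  \<open>d\<close>-dimensional Wiener process on the time axis \<open>[0, \<infinity>)\<close>.  The joint independence over component
  and time interval expresses both that the increments are independent and that the components are
  independent of each other.
\<close>

definition wiener_process :: "'w measure \<Rightarrow> nat \<Rightarrow> (nat \<Rightarrow> real \<Rightarrow> 'w \<Rightarrow> real) \<Rightarrow> bool" where
  "wiener_process P d W \<longleftrightarrow>
     prob_space P \<and>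
     (\<forall>t \<omega>. W 0 t \<omega> = t) \<and>
     (\<forall>i\<in>{1..d}. \<forall>t\<ge>0. W i t \<in> borel_measurable P) \<and>
     (\<forall>i\<in>{1..d}. AE \<omega> in P. W i 0 \<omega> = 0) \<and>
     (\<forall>i\<in>{1..d}. AE \<omega> in P. continuous_on {0..} (\<lambda>t. W i t \<omega>)) \<and>
     (\<forall>i\<in>{1..d}. \<forall>s t. 0 \<le> s \<and> s < t \<longrightarrow>
        distributed P lborel (\<lambda>\<omega>. W i t \<omega> - W i s \<omega>) (normal_density 0 (sqrt (t - s)))) \<and>
     (\<forall>\<tau> m. 0 \<le> \<tau> 0 \<and> mono (\<tau> :: nat \<Rightarrow> real) \<longrightarrow>
        prob_space.indep_vars P (\<lambda>_. borel)
          (\<lambda>(i, k) \<omega>. W i (\<tau> (Suc k)) \<omega> - W i (\<tau> k) \<omega>) ({1..d} \<times> {..<m}))"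

definition partition_finer ::
    "real \<Rightarrow> real \<Rightarrow> real \<Rightarrow> nat \<Rightarrow> (nat \<Rightarrow> real) \<Rightarrow> bool" where
  "partition_finer \<delta> s t m p \<longleftrightarrow>
     p 0 = s \<and> p m = t \<and> (\<forall>k<m. p k \<le> p (Suc k) \<and> p (Suc k) - p k < \<delta>)"

definition trapezoidal_sum ::
    "(real \<Rightarrow> 'w \<Rightarrow> real) \<Rightarrow> (real \<Rightarrow> 'w \<Rightarrow> real) \<Rightarrow> nat \<Rightarrow> (nat \<Rightarrow> real) \<Rightarrow> 'w \<Rightarrow> real" where
  "trapezoidal_sum Y X m p \<omega> =
     (\<Sum>k<m. (Y (p k) \<omega> + Y (p (Suc k)) \<omega>) / 2 * (X (p (Suc k)) \<omega> - X (p k) \<omega>))"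

text \<open>
  \<open>I\<close> is (a version of) the Stratonovich integral of \<open>Y\<close> against \<open>X\<close> over \<open>[s, t]\<close>: the limit in
  probability of the trapezoidal sums over deterministic partitions as the mesh tends to zero.
  The measurability clauses are needed because \<open>measure\<close> is 0 on non-measurable sets.
\<close>

definition stratonovich_integral ::
    "'w measure \<Rightarrow> (real \<Rightarrow> 'w \<Rightarrow> real) \<Rightarrow> (real \<Rightarrow> 'w \<Rightarrow> real) \<Rightarrow> real \<Rightarrow> real \<Rightarrow> ('w \<Rightarrow> real) \<Rightarrow> bool"
  where
  "stratonovich_integral P Y X s t I \<longleftrightarrow>
     I \<in> borel_measurable P \<and>
     (\<forall>\<tau>\<in>{s..t}. Y \<tau> \<in> borel_measurable P \<and> X \<tau> \<in> borel_measurable P) \<and>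
     (\<forall>\<epsilon>>0. \<exists>\<delta>>0. \<forall>m p. partition_finer \<delta> s t m p \<longrightarrow>
        measure P {\<omega> \<in> space P. \<bar>trapezoidal_sum Y X m p \<omega> - I \<omega>\<bar> > \<epsilon>} < \<epsilon>)"

text \<open>
  \<open>J \<alpha> s t\<close> is the multiple Stratonovich integral with multi-index \<open>\<alpha>\<close> over \<open>[s, t]\<close>; the last entry
  of \<open>\<alpha>\<close> belongs to the outermost integration.  Each integral is determined up to null sets only, so
  this is a predicate on a family \<open>J\<close> of versions.
\<close>

definition multiple_stratonovich ::
    "'w measure \<Rightarrow> nat \<Rightarrow> (nat \<Rightarrow> real \<Rightarrow> 'w \<Rightarrow> real) \<Rightarrow>
     (nat list \<Rightarrow> real \<Rightarrow> real \<Rightarrow> 'w \<Rightarrow> real) \<Rightarrow> bool" where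
  "multiple_stratonovich P d W J \<longleftrightarrow>
     (\<forall>a\<in>{0..d}. \<forall>s t. 0 \<le> s \<and> s \<le> t \<longrightarrow> J [a] s t = (\<lambda>\<omega>. W a t \<omega> - W a s \<omega>)) \<and>
     (\<forall>\<alpha> a s t. \<alpha> \<noteq> [] \<and> set \<alpha> \<subseteq> {0..d} \<and> a \<in> {0..d} \<and> 0 \<le> s \<and> s \<le> t \<longrightarrow>
        stratonovich_integral P (J \<alpha> s) (W a) s t (J (\<alpha> @ [a]) s t))"

text \<open>
  In the following, \<open>N\<close> is the number of steps of \<open>[0, T]\<close> and \<open>Q\<close> the number of subintervals of each
  step.  The limit \<open>h \<longlonglongrightarrow> 0\<close> is taken along \<open>N \<longlonglongrightarrow> \<infinity>\<close>, with \<open>h = T / N\<close>.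
\<close>

definition step_size :: "real \<Rightarrow> nat \<Rightarrow> real" where
  "step_size T N = T / real N"

definition grid :: "real \<Rightarrow> nat \<Rightarrow> nat \<Rightarrow> real" where
  "grid T N n = real n * step_size T N"

definition increment ::
    "(nat \<Rightarrow> real \<Rightarrow> 'w \<Rightarrow> real) \<Rightarrow> real \<Rightarrow> nat \<Rightarrow> nat \<Rightarrow> nat \<Rightarrow> nat \<Rightarrow> nat \<Rightarrow> 'w \<Rightarrow> real" where
  "increment W T N Q i n q \<omega> =
     (let \<Delta>t = step_size T N / real Q
      in W i (grid T N n + real (q + 1) * \<Delta>t) \<omega> - W i (grid T N n + real q * \<Delta>t) \<omega>)"

definition increment_algebra ::
    "'w measure \<Rightarrow> nat \<Rightarrow> (nat \<Rightarrow> real \<Rightarrow> 'w \<Rightarrow> real) \<Rightarrow> real \<Rightarrow> nat \<Rightarrow> nat \<Rightarrow> 'w measure" where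
  "increment_algebra P d W T N Q =
     sigma (space P)
       (\<Union>i\<in>{1..d}. \<Union>n\<in>{..<N}. \<Union>q\<in>{..<Q}.
          {increment W T N Q i n q -` B \<inter> space P | B. B \<in> sets borel})"

definition L2_norm_rv :: "'w measure \<Rightarrow> ('w \<Rightarrow> real) \<Rightarrow> real" where
  "L2_norm_rv P X = sqrt (\<integral>\<omega>. (X \<omega>)\<^sup>2 \<partial>P)"

definition local_error ::
    "'w measure \<Rightarrow> nat \<Rightarrow> (nat \<Rightarrow> real \<Rightarrow> 'w \<Rightarrow> real) \<Rightarrow> (nat list \<Rightarrow> real \<Rightarrow> real \<Rightarrow> 'w \<Rightarrow> real) \<Rightarrow>
     real \<Rightarrow> nat list \<Rightarrow> nat \<Rightarrow> nat \<Rightarrow> nat \<Rightarrow> 'w \<Rightarrow> real" where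
  "local_error P d W J T \<alpha> N Q n \<omega> =
     (let X = J \<alpha> (grid T N n) (grid T N (n + 1))
      in X \<omega> - real_cond_exp P (increment_algebra P d W T N Q) X \<omega>)"

definition global_error ::
    "'w measure \<Rightarrow> nat \<Rightarrow> (nat \<Rightarrow> real \<Rightarrow> 'w \<Rightarrow> real) \<Rightarrow> (nat list \<Rightarrow> real \<Rightarrow> real \<Rightarrow> 'w \<Rightarrow> real) \<Rightarrow>
     real \<Rightarrow> nat list \<Rightarrow> nat \<Rightarrow> nat \<Rightarrow> real" where
  "global_error P d W J T \<alpha> N Q =
     L2_norm_rv P (\<lambda>\<omega>. \<Sum>n<N. local_error P d W J T \<alpha> N Q n \<omega>)"

text \<open>
  Convention: a global error of order \<open>h\<^sup>M\<close> means that the local errors have \<open>L\<^sup>2\<close>-norm of order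
  \<open>h\<close> to the power \<open>M + 1/2\<close>, here uniformly over the steps.  \<open>error_upto_order\<close> is the upper half of
  this; \<open>error_of_order\<close> is the two-sided version, which excludes wastefully large \<open>Q\<close>.
\<close>

definition error_upto_order ::
    "'w measure \<Rightarrow> nat \<Rightarrow> (nat \<Rightarrow> real \<Rightarrow> 'w \<Rightarrow> real) \<Rightarrow> (nat list \<Rightarrow> real \<Rightarrow> real \<Rightarrow> 'w \<Rightarrow> real) \<Rightarrow>
     real \<Rightarrow> nat list \<Rightarrow> (nat \<Rightarrow> nat) \<Rightarrow> real \<Rightarrow> bool" where
  "error_upto_order P d W J T \<alpha> Q M \<longleftrightarrow>
     (\<exists>C>0. \<forall>\<^sub>F N in sequentially. \<forall>n<N.
        L2_norm_rv P (local_error P d W J T \<alpha> N (Q N) n) \<le> C * step_size T N powr (M + 1/2))"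

definition error_of_order ::
    "'w measure \<Rightarrow> nat \<Rightarrow> (nat \<Rightarrow> real \<Rightarrow> 'w \<Rightarrow> real) \<Rightarrow> (nat list \<Rightarrow> real \<Rightarrow> real \<Rightarrow> 'w \<Rightarrow> real) \<Rightarrow>
     real \<Rightarrow> nat list \<Rightarrow> (nat \<Rightarrow> nat) \<Rightarrow> real \<Rightarrow> bool" where
  "error_of_order P d W J T \<alpha> Q M \<longleftrightarrow>
     error_upto_order P d W J T \<alpha> Q M \<and>
     (\<exists>c>0. \<forall>\<^sub>F N in sequentially. \<forall>n<N.
        L2_norm_rv P (local_error P d W J T \<alpha> N (Q N) n) \<ge> c * step_size T N powr (M + 1/2))"

text \<open>
  Cost model: evaluating an \<open>(l - 1)\<close>-multiple sum over \<open>Q N\<close> sub-increments on each of \<open>N\<close> steps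
  takes \<open>U N\<close> flops.  A flop count is positive; this has to be said because negative powers of \<open>U N\<close>
  are used, and \<open>0 powr x = 0\<close>.
\<close>

definition quadrature_effort :: "nat \<Rightarrow> (nat \<Rightarrow> nat) \<Rightarrow> (nat \<Rightarrow> real) \<Rightarrow> bool" where
  "quadrature_effort l Q U \<longleftrightarrow>
     (\<forall>\<^sub>F N in sequentially. U N > 0) \<and>
     U \<in> O(\<lambda>N. real (Q N) ^ (l - 1) * real N)"

definition effort_exponent :: "real \<Rightarrow> nat \<Rightarrow> real" where
  "effort_exponent M l = (real l - 1) * (2 * M + 1 - real l) + 1"

end

theory Submission
  imports Defs
begin

text \<open>
  Write \<open>l\<close> for the length of \<open>\<alpha>\<close>, \<open>h\<close> for the step size and \<open>\<gamma> = 2 M + 1 - l\<close>.  Everything follows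
  from two facts about the local errors.

  First, a local error is at most of order \<open>h\<^bsup>l/2\<^esup> / \<surd>Q\<close> in \<open>L\<^sup>2\<close> (\<open>local_error_bound\<close>).  Replace every
  integration in \<open>J \<alpha>\<close> by the trapezoidal rule on the \<open>Q\<close> cells of a step.  The result is a multilinear
  form in the increments of the cells.  Because the indices are distinct, its monomials are
  products of independent increments, and different monomials are orthogonal, so an \<open>L\<^sup>2\<close> distance
  between two such forms is a sum of squared differences of deterministic coefficients
  (\<open>multilinear_form_isometry\<close>).  Refining the grid changes a coefficient only where two consecutive
  integration variables share a coarse cell, which is a fraction of order \<open>1 / Q\<close> of all index
  tuples (\<open>card_near_diagonal\<close>).  Passing to the limit gives the distance \<open>h\<^bsup>l/2\<^esup> / \<surd>Q\<close>, up to a constant,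
  between the form and the Stratonovich integral (\<open>strong_approximation\<close>).  The form is a function of
  the observed increments, and the conditional expectation is the best such function in \<open>L\<^sup>2\<close>.

  Second, local errors on different steps are orthogonal (\<open>defects_orthogonal\<close>), since what happens
  off a step is independent of what happens on it; therefore conditioning on all increments amounts
  to conditioning on those of the step (\<open>cond_exp_is_local\<close>).  Hence the squared global error is the
  sum of the \<open>N = T / h\<close> squared local errors, and local order \<open>M + 1/2\<close> becomes global order \<open>M\<close>.

  A number \<open>Q\<close> of subintervals of order \<open>h\<close> to the power \<open>-\<gamma>\<close> suffices for local order \<open>M + 1/2\<close>
  (\<open>sufficient_subdivision\<close>), and a local error that is also bounded below by this order forces \<open>Q\<close> to
  be at most of that order (\<open>necessary_subdivision\<close>).  In both cases the effort \<open>Q\<^bsup>l - 1\<^esup> N\<close> is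
  at most of order \<open>h\<close> to the power \<open>-((l - 1) \<gamma> + 1)\<close>, and solving for \<open>h\<close> expresses the error by
  the effort.
\<close>

section \<open>Weights of the iterated trapezoidal rule\<close>

definition step_weight :: "nat \<Rightarrow> nat \<Rightarrow> real" where
  "step_weight i j = (if i < j then 1 else if i = j then 1/2 else 0)"

text \<open>
  The coefficient with which the increments over the cells \<open>\<kappa> a\<close>, for \<open>a\<close> in \<open>\<alpha>\<close>, occur in the
  iterated trapezoidal sum: consecutive cells have to be in increasing order, and every tie costs a
  factor \<open>1/2\<close>, the value of the trapezoidal rule on a single cell.  Cells are indexed by the
  components of \<open>W\<close> rather than by positions in \<open>\<alpha>\<close>, which is possible because indices are distinct.
\<close>

definition chain_weight :: "nat list \<Rightarrow> (nat \<Rightarrow> nat) \<Rightarrow> real" where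
  "chain_weight \<alpha> \<kappa> = (\<Prod>i<length \<alpha> - 1. step_weight (\<kappa> (\<alpha> ! i)) (\<kappa> (\<alpha> ! Suc i)))"

lemma step_weight_bounds: "0 \<le> step_weight i j" "step_weight i j \<le> 1"
  by (auto simp: step_weight_def)

lemma chain_weight_bounds: "0 \<le> chain_weight \<alpha> \<kappa>" "chain_weight \<alpha> \<kappa> \<le> 1"
  by (auto simp: chain_weight_def intro!: prod_nonneg prod_le_1 step_weight_bounds)

lemma chain_weight_snoc:
  assumes "\<alpha> \<noteq> []"
  shows "chain_weight (\<alpha> @ [a]) \<kappa> = chain_weight \<alpha> \<kappa> * step_weight (\<kappa> (last \<alpha>)) (\<kappa> a)"
proof -
  obtain m where m: "length \<alpha> = Suc m" using assms by (cases \<alpha>) auto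
  have "last \<alpha> = \<alpha> ! m" using assms m by (simp add: last_conv_nth)
  then show ?thesis
    by (simp add: chain_weight_def m nth_append)
qed

lemma chain_weight_singleton [simp]: "chain_weight [a] \<kappa> = 1"
  by (simp add: chain_weight_def)

lemma chain_weight_cong:
  assumes "\<And>a. a \<in> set \<alpha> \<Longrightarrow> \<kappa> a = \<kappa>' a"
  shows "chain_weight \<alpha> \<kappa> = chain_weight \<alpha> \<kappa>'"
  unfolding chain_weight_def using assms by (intro prod.cong) auto

lemma chain_weight_support:
  assumes "\<alpha> \<noteq> []" "chain_weight \<alpha> \<kappa> \<noteq> 0" "b \<in> set \<alpha>"
  shows "\<kappa> b \<le> \<kappa> (last \<alpha>)"
  using assms
proof (induction \<alpha> rule: rev_induct)
  case (snoc a \<alpha>)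
  show ?case
  proof (cases "b = a")
    case False
    then have b: "b \<in> set \<alpha>" "\<alpha> \<noteq> []" using snoc.prems by auto
    then have "chain_weight \<alpha> \<kappa> \<noteq> 0" "\<kappa> (last \<alpha>) \<le> \<kappa> a"
      using snoc.prems by (auto simp: chain_weight_snoc step_weight_def split: if_splits)
    then show ?thesis using snoc.IH b by simp
  qed simp
qed simp

text \<open>
  Merging \<open>p\<close> neighbouring cells leaves the order of two cells visible unless they are merged into one.
\<close>

lemma step_weight_block_eq:
  assumes "i div p \<noteq> j div p"
  shows "step_weight i j = step_weight (i div p) (j div p)"
proof (cases i j rule: linorder_cases)
  case less
  then have "i div p \<le> j div p" by (simp add: div_le_mono)
  then show ?thesis using assms less by (auto simp: step_weight_def)
next
  case greater
  then have "j div p \<le> i div p" by (simp add: div_le_mono)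
  then show ?thesis using assms greater by (auto simp: step_weight_def)
qed (use assms in auto)

text \<open>
  The index tuples on which merging blocks of \<open>p\<close> cells can change the weight.
\<close>

definition near_diagonal :: "nat list \<Rightarrow> nat \<Rightarrow> (nat \<Rightarrow> nat) \<Rightarrow> bool" where
  "near_diagonal \<alpha> p \<kappa> \<longleftrightarrow> (\<exists>i<length \<alpha> - 1. \<kappa> (\<alpha> ! i) div p = \<kappa> (\<alpha> ! Suc i) div p)"

lemma card_same_block:
  fixes S :: "nat set"
  assumes "finite S" "a \<in> S" "b \<in> S" "a \<noteq> b" "p > 0"
  shows "card {\<kappa> \<in> PiE S (\<lambda>_. {..<n}). \<kappa> a div p = \<kappa> b div p} \<le> n ^ (card S - 1) * p"
proof -
  let ?B = "{\<kappa> \<in> PiE S (\<lambda>_. {..<n}). \<kappa> a div p = \<kappa> b div p}"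
  \<comment> \<open>the block of b is known from a, so that b only contributes its position within the block\<close>
  let ?f = "\<lambda>\<kappa>. (restrict \<kappa> (S - {b}), \<kappa> b mod p)"
  have "inj_on ?f ?B"
  proof (rule inj_onI)
    fix \<kappa> \<kappa>' assume *: "\<kappa> \<in> ?B" "\<kappa>' \<in> ?B" "?f \<kappa> = ?f \<kappa>'"
    then have 1: "\<kappa> c = \<kappa>' c" if "c \<in> S" "c \<noteq> b" for c
      using that by (auto simp: fun_eq_iff restrict_def) metis
    have "\<kappa> b div p = \<kappa>' b div p" using * 1[of a] assms by auto
    then have "\<kappa> b = \<kappa>' b" using * by (metis (no_types, lifting) div_mult_mod_eq prod.inject)
    with 1 have "\<kappa> c = \<kappa>' c" if "c \<in> S" for c using that by metis
    then show "\<kappa> = \<kappa>'" using * by (intro PiE_ext[of \<kappa> S "\<lambda>_. {..<n}"]) auto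
  qed
  moreover have "?f ` ?B \<subseteq> PiE (S - {b}) (\<lambda>_. {..<n}) \<times> {..<p}"
    using assms by (auto simp: PiE_iff extensional_def split: if_split_asm)
  moreover have "finite (PiE (S - {b}) (\<lambda>_. {..<n}) \<times> {..<p})"
    using assms by (auto intro!: finite_PiE)
  ultimately have "card ?B \<le> card (PiE (S - {b}) (\<lambda>_. {..<n}) \<times> {..<p})"
    by (rule card_inj_on_le)
  also have "\<dots> = n ^ (card S - 1) * p"
    using assms by (simp add: card_PiE card_cartesian_product)
  finally show ?thesis .
qed

text \<open>
  Compared with all \<open>n\<^bsup>l\<^esup>\<close> tuples this is a fraction \<open>(l - 1) p / n\<close>, which is where the rate \<open>1 / Q\<close>
  comes from.
\<close>

lemma card_near_diagonal:
  assumes "distinct \<alpha>" "p > 0"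
  shows "card {\<kappa> \<in> PiE (set \<alpha>) (\<lambda>_. {..<n}). near_diagonal \<alpha> p \<kappa>}
         \<le> (length \<alpha> - 1) * (n ^ (length \<alpha> - 1) * p)"
proof -
  let ?B = "\<lambda>i. {\<kappa> \<in> PiE (set \<alpha>) (\<lambda>_. {..<n}). \<kappa> (\<alpha> ! i) div p = \<kappa> (\<alpha> ! Suc i) div p}"
  have "{\<kappa> \<in> PiE (set \<alpha>) (\<lambda>_. {..<n}). near_diagonal \<alpha> p \<kappa>} = (\<Union>i<length \<alpha> - 1. ?B i)"
    by (auto simp: near_diagonal_def)
  also have "card \<dots> \<le> (\<Sum>i<length \<alpha> - 1. card (?B i))"
    by (rule card_UN_le) simp
  also have "\<dots> \<le> (\<Sum>i<length \<alpha> - 1. n ^ (length \<alpha> - 1) * p)"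
  proof (rule sum_mono)
    fix i assume "i \<in> {..<length \<alpha> - 1}"
    then show "card (?B i) \<le> n ^ (length \<alpha> - 1) * p"
      using card_same_block[of "set \<alpha>" "\<alpha> ! i" "\<alpha> ! Suc i" p n] assms
      by (auto simp: distinct_card nth_eq_iff_index_eq)
  qed
  finally show ?thesis by simp
qed

section \<open>Multilinear forms in the increments of a grid\<close>

definition multilinear_form :: "(nat \<Rightarrow> nat \<Rightarrow> real) \<Rightarrow> nat set \<Rightarrow> nat \<Rightarrow> ((nat \<Rightarrow> nat) \<Rightarrow> real) \<Rightarrow> real" where
  "multilinear_form x S n c = (\<Sum>\<kappa>\<in>PiE S (\<lambda>_. {..<n}). c \<kappa> * (\<Prod>a\<in>S. x a (\<kappa> a)))"

lemma multilinear_form_empty: "multilinear_form x {} n c = c (\<lambda>_. undefined)"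
  by (simp add: multilinear_form_def)

lemma multilinear_form_cong:
  assumes "\<And>\<kappa>. \<kappa> \<in> PiE S (\<lambda>_. {..<n}) \<Longrightarrow> c \<kappa> = c' \<kappa>"
    and "\<And>a k. a \<in> S \<Longrightarrow> k < n \<Longrightarrow> x a k = x' a k"
  shows "multilinear_form x S n c = multilinear_form x' S n c'"
  unfolding multilinear_form_def
proof (rule sum.cong[OF refl])
  fix \<kappa> assume \<kappa>: "\<kappa> \<in> PiE S (\<lambda>_. {..<n})"
  then have "(\<Prod>a\<in>S. x a (\<kappa> a)) = (\<Prod>a\<in>S. x' a (\<kappa> a))"
    by (intro prod.cong assms(2)) auto
  then show "c \<kappa> * (\<Prod>a\<in>S. x a (\<kappa> a)) = c' \<kappa> * (\<Prod>a\<in>S. x' a (\<kappa> a))"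
    using assms(1)[OF \<kappa>] by simp
qed

lemma multilinear_form_diff: "multilinear_form x S n c - multilinear_form x S n c' = multilinear_form x S n (\<lambda>\<kappa>. c \<kappa> - c' \<kappa>)"
  by (simp add: multilinear_form_def sum_subtractf left_diff_distrib)

lemma multilinear_form_insert:
  assumes "finite S" "a \<notin> S"
  shows "multilinear_form x (insert a S) n c = (\<Sum>k<n. x a k * multilinear_form x S n (\<lambda>\<kappa>. c (\<kappa>(a := k))))"
proof -
  have "multilinear_form x (insert a S) n c = 
     (\<Sum>(k,\<kappa>)\<in>{..<n} \<times> PiE S (\<lambda>_. {..<n}). c (\<kappa>(a := k)) * (\<Prod>b\<in>insert a S. x b ((\<kappa>(a := k)) b)))"
    unfolding multilinear_form_def PiE_insert_eq
    by (subst sum.reindex) (auto intro!: inj_combinator[OF assms(2)] sum.cong)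
  also have "\<dots> = (\<Sum>(k,\<kappa>)\<in>{..<n} \<times> PiE S (\<lambda>_. {..<n}). x a k * (c (\<kappa>(a := k)) * (\<Prod>b\<in>S. x b (\<kappa> b))))"
  proof (intro sum.cong refl, clarify)
    fix k \<kappa>
    have "(\<Prod>b\<in>S. x b ((\<kappa>(a := k)) b)) = (\<Prod>b\<in>S. x b (\<kappa> b))"
      using assms by (intro prod.cong) auto
    then show "c (\<kappa>(a := k)) * (\<Prod>b\<in>insert a S. x b ((\<kappa>(a := k)) b)) =
        x a k * (c (\<kappa>(a := k)) * (\<Prod>b\<in>S. x b (\<kappa> b)))"
      using assms by simp
  qed
  also have "\<dots> = (\<Sum>k<n. x a k * multilinear_form x S n (\<lambda>\<kappa>. c (\<kappa>(a := k))))"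
    by (simp add: sum.cartesian_product[symmetric] multilinear_form_def sum_distrib_left)
  finally show ?thesis .
qed

lemma sum_over_blocks:
  fixes g :: "nat \<Rightarrow> nat \<Rightarrow> real"
  assumes "R > 0"
  shows "(\<Sum>j<n. \<Sum>k\<in>{j*R..<Suc j*R}. g j k) = (\<Sum>k<n*R. g (k div R) k)"
proof (induction n)
  case (Suc n)
  have "{..<Suc n * R} = {..<n*R} \<union> {n*R..<Suc n*R}" by auto
  then have "(\<Sum>k<Suc n*R. g (k div R) k) = (\<Sum>k<n*R. g (k div R) k) + (\<Sum>k\<in>{n*R..<Suc n*R}. g (k div R) k)"
    by (simp add: sum.union_disjoint ivl_disj_int)
  also have "(\<Sum>k\<in>{n*R..<Suc n*R}. g (k div R) k) = (\<Sum>k\<in>{n*R..<Suc n*R}. g n k)"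
  proof (intro sum.cong refl)
    fix k assume "k \<in> {n*R..<Suc n*R}"
    then have "k div R = n" using assms
      by (metis atLeastLessThan_iff mult.commute div_nat_eqI)
    then show "g (k div R) k = g n k" by simp
  qed
  finally show ?case using Suc by simp
qed simp

text \<open>
  Both grids are expressed on the finer one, so that approximations with different resolution become
  forms in the same variables and can be compared coefficient by coefficient.
\<close>

lemma multilinear_form_coarsen:
  assumes "finite S" "R > 0"
  shows "multilinear_form (\<lambda>a j. \<Sum>k\<in>{j*R..<Suc j*R}. x a k) S n c =
         multilinear_form x S (n*R) (\<lambda>\<kappa>. c (restrict (\<lambda>a. \<kappa> a div R) S))"
  using assms(1)
proof (induction S arbitrary: c rule: finite_induct)
  case empty
  then show ?case by (simp add: multilinear_form_def)
next
  case (insert a S)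
  have eq: "(restrict (\<lambda>b. \<kappa> b div R) S)(a := k div R) = restrict (\<lambda>b. (\<kappa>(a := k)) b div R) (insert a S)"
    for \<kappa> k using insert.hyps by (auto simp: restrict_def fun_eq_iff)
  have "multilinear_form (\<lambda>a j. \<Sum>k\<in>{j*R..<Suc j*R}. x a k) (insert a S) n c =
      (\<Sum>j<n. \<Sum>k\<in>{j*R..<Suc j*R}. x a k * multilinear_form x S (n*R) (\<lambda>\<kappa>. c ((restrict (\<lambda>a. \<kappa> a div R) S)(a := j))))"
    by (simp only: multilinear_form_insert[OF insert.hyps] insert.IH sum_distrib_right)
  also have "\<dots> = (\<Sum>k<n*R. x a k * multilinear_form x S (n*R) (\<lambda>\<kappa>. c ((restrict (\<lambda>a. \<kappa> a div R) S)(a := k div R))))"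
    by (rule sum_over_blocks[OF assms(2)])
  also have "\<dots> = multilinear_form x (insert a S) (n*R) (\<lambda>\<kappa>. c (restrict (\<lambda>a. \<kappa> a div R) (insert a S)))"
    by (simp only: multilinear_form_insert[OF insert.hyps] eq)
  finally show ?case .
qed

text \<open>
  Weights vanish unless the last cell is the largest, so stopping the iterated sum at the cell \<open>j*R\<close>
  is a condition on the last index alone.
\<close>

lemma multilinear_form_truncate:
  assumes "\<alpha> \<noteq> []" "j \<le> m" "R > 0"
  shows "multilinear_form x (set \<alpha>) (j*R) (chain_weight \<alpha>) =
    multilinear_form x (set \<alpha>) (m*R) (\<lambda>\<kappa>. if \<kappa> (last \<alpha>) div R < j then chain_weight \<alpha> \<kappa> else 0)"
  unfolding multilinear_form_def
proof (rule sum.mono_neutral_cong_left)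
  have "j * R \<le> m * R" using assms by simp
  then show "PiE (set \<alpha>) (\<lambda>_. {..<j*R}) \<subseteq> PiE (set \<alpha>) (\<lambda>_. {..<m*R})"
    by (intro PiE_mono) auto
  show "\<forall>\<kappa>\<in>PiE (set \<alpha>) (\<lambda>_. {..<m*R}) - PiE (set \<alpha>) (\<lambda>_. {..<j*R}).
     (if \<kappa> (last \<alpha>) div R < j then chain_weight \<alpha> \<kappa> else 0) * (\<Prod>a\<in>set \<alpha>. x a (\<kappa> a)) = 0"
  proof
    fix \<kappa> assume \<kappa>: "\<kappa> \<in> PiE (set \<alpha>) (\<lambda>_. {..<m*R}) - PiE (set \<alpha>) (\<lambda>_. {..<j*R})"
    have "chain_weight \<alpha> \<kappa> = 0" if "\<kappa> (last \<alpha>) div R < j"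
    proof (rule ccontr)
      assume nz: "chain_weight \<alpha> \<kappa> \<noteq> 0"
      have "\<kappa> (last \<alpha>) < j * R" using that assms by (simp add: div_less_iff_less_mult)
      then have "\<kappa> b < j*R" if "b \<in> set \<alpha>" for b
        using chain_weight_support[OF assms(1) nz that] by simp
      then have "\<kappa> \<in> PiE (set \<alpha>) (\<lambda>_. {..<j*R})" using \<kappa> by (auto simp: PiE_iff)
      then show False using \<kappa> by simp
    qed
    then show "(if \<kappa> (last \<alpha>) div R < j then chain_weight \<alpha> \<kappa> else 0) * (\<Prod>a\<in>set \<alpha>. x a (\<kappa> a)) = 0"
      by simp
  qed
  fix \<kappa> assume "\<kappa> \<in> PiE (set \<alpha>) (\<lambda>_. {..<j*R})"
  then have "\<kappa> (last \<alpha>) < j * R" using assms by (auto simp: PiE_iff)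
  then show "chain_weight \<alpha> \<kappa> * (\<Prod>a\<in>set \<alpha>. x a (\<kappa> a)) =
     (if \<kappa> (last \<alpha>) div R < j then chain_weight \<alpha> \<kappa> else 0) * (\<Prod>a\<in>set \<alpha>. x a (\<kappa> a))"
    using assms by (simp add: div_less_iff_less_mult)
qed (auto intro!: finite_PiE)

text \<open>
  One more integration, by the trapezoidal rule with coarse nodes every \<open>R\<close> cells.  The mean of the
  truncations at \<open>j\<close> and at \<open>j + 1\<close> weighs the last cell by \<open>1\<close> before the \<open>j\<close>-th block, by
  \<open>1/2\<close> in it and by \<open>0\<close> after it, and this is \<open>step_weight\<close>.
\<close>

lemma multilinear_form_trapezoid:
  assumes "\<alpha> \<noteq> []" "a \<notin> set \<alpha>" "R > 0"
  shows "(\<Sum>j<m. (multilinear_form x (set \<alpha>) (j*R) (chain_weight \<alpha>) + multilinear_form x (set \<alpha>) (Suc j*R) (chain_weight \<alpha>)) / 2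
             * (\<Sum>k\<in>{j*R..<Suc j*R}. x a k))
    = multilinear_form x (set (\<alpha> @ [a])) (m*R)
        (\<lambda>\<kappa>. chain_weight \<alpha> \<kappa> * step_weight (\<kappa> (last \<alpha>) div R) (\<kappa> a div R))"
proof -
  let ?S = "set \<alpha>"
  let ?c = "\<lambda>j \<kappa>. chain_weight \<alpha> \<kappa> * step_weight (\<kappa> (last \<alpha>) div R) j"
  have half: "(multilinear_form x ?S (j*R) (chain_weight \<alpha>) + multilinear_form x ?S (Suc j*R) (chain_weight \<alpha>)) / 2
      = multilinear_form x ?S (m*R) (?c j)" if "j < m" for j
  proof -
    have "multilinear_form x ?S (j*R) (chain_weight \<alpha>) + multilinear_form x ?S (Suc j*R) (chain_weight \<alpha>)
       = multilinear_form x ?S (m*R) (\<lambda>\<kappa>. (if \<kappa> (last \<alpha>) div R < j then chain_weight \<alpha> \<kappa> else 0) +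
           (if \<kappa> (last \<alpha>) div R < Suc j then chain_weight \<alpha> \<kappa> else 0))"
      using that assms multilinear_form_truncate[of \<alpha> j m R x] multilinear_form_truncate[of \<alpha> "Suc j" m R x]
      by (simp add: multilinear_form_def sum.distrib distrib_right)
    also have "\<dots> = multilinear_form x ?S (m*R) (\<lambda>\<kappa>. 2 * ?c j \<kappa>)"
      by (intro multilinear_form_cong) (auto simp: step_weight_def)
    also have "\<dots> = 2 * multilinear_form x ?S (m*R) (?c j)"
      by (simp add: multilinear_form_def sum_distrib_left mult.assoc)
    finally show ?thesis by simp
  qed
  have "(\<Sum>j<m. (multilinear_form x ?S (j*R) (chain_weight \<alpha>) + multilinear_form x ?S (Suc j*R) (chain_weight \<alpha>)) / 2
             * (\<Sum>k\<in>{j*R..<Suc j*R}. x a k))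
     = (\<Sum>j<m. \<Sum>k\<in>{j*R..<Suc j*R}. x a k * multilinear_form x ?S (m*R) (?c j))"
    by (intro sum.cong refl, subst half) (simp_all only: lessThan_iff sum_distrib_right[symmetric] mult.commute)
  also have "\<dots> = (\<Sum>k<m*R. x a k * multilinear_form x ?S (m*R) (?c (k div R)))"
    by (rule sum_over_blocks[OF assms(3)])
  also have "\<dots> = (\<Sum>k<m*R. x a k * multilinear_form x ?S (m*R) (\<lambda>\<kappa>. (\<lambda>\<kappa>. chain_weight \<alpha> \<kappa> * step_weight (\<kappa> (last \<alpha>) div R) (\<kappa> a div R)) (\<kappa>(a := k))))"
  proof -
    have "chain_weight \<alpha> (\<kappa>(a := k)) = chain_weight \<alpha> \<kappa>" for \<kappa> k
      using assms by (intro chain_weight_cong) auto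
    moreover have "last \<alpha> \<noteq> a" using assms by auto
    ultimately show ?thesis by simp
  qed
  also have "\<dots> = multilinear_form x (insert a ?S) (m*R) (\<lambda>\<kappa>. chain_weight \<alpha> \<kappa> * step_weight (\<kappa> (last \<alpha>) div R) (\<kappa> a div R))"
    using assms by (subst multilinear_form_insert) auto
  finally show ?thesis by simp
qed

text \<open>
  The left coefficient resolves the inner integrals on the fine grid and the last one on blocks of \<open>R\<close>
  cells; the right one resolves all of them on blocks of \<open>r * R\<close> cells only.
\<close>

lemma trapezoid_coefficient_diff:
  assumes "\<alpha> \<noteq> []"
  shows "(chain_weight \<alpha> \<kappa> * step_weight (\<kappa> (last \<alpha>) div R) (\<kappa> a div R)
      - chain_weight (\<alpha> @ [a]) (\<lambda>b. \<kappa> b div (r * R)))\<^sup>2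
    \<le> (if near_diagonal (\<alpha> @ [a]) (r * R) \<kappa> then 1 else 0)" (is "(?u - ?v)\<^sup>2 \<le> _")
proof (cases "near_diagonal (\<alpha> @ [a]) (r * R) \<kappa>")
  case True
  have "0 \<le> ?u" "?u \<le> 1"
    by (auto intro!: mult_nonneg_nonneg mult_le_one chain_weight_bounds step_weight_bounds)
  then have "\<bar>?u - ?v\<bar> \<le> 1"
    using chain_weight_bounds[of "\<alpha> @ [a]" "\<lambda>b. \<kappa> b div (r * R)"] by linarith
  then show ?thesis using True by (simp add: abs_square_le_1)
next
  case False
  obtain m where m: "length \<alpha> = Suc m" using assms by (cases \<alpha>) auto
  have l: "last \<alpha> = \<alpha> ! m" using assms m by (simp add: last_conv_nth)
  have ne: "\<kappa> ((\<alpha> @ [a]) ! i) div (r*R) \<noteq> \<kappa> ((\<alpha> @ [a]) ! Suc i) div (r*R)" if "i < length \<alpha>" for i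
    using False that by (auto simp: near_diagonal_def)
  have "chain_weight \<alpha> \<kappa> = chain_weight \<alpha> (\<lambda>b. \<kappa> b div (r * R))"
    unfolding chain_weight_def
  proof (intro prod.cong refl step_weight_block_eq)
    fix i assume "i \<in> {..<length \<alpha> - 1}"
    then show "\<kappa> (\<alpha> ! i) div (r*R) \<noteq> \<kappa> (\<alpha> ! Suc i) div (r*R)"
      using ne[of i] m by (simp add: nth_append)
  qed
  moreover have "step_weight (\<kappa> (last \<alpha>) div R) (\<kappa> a div R)
      = step_weight (\<kappa> (last \<alpha>) div (r*R)) (\<kappa> a div (r*R))"
    using step_weight_block_eq[of "\<kappa> (last \<alpha>) div R" r "\<kappa> a div R"] ne[of m] m l
    by (simp add: nth_append div_mult2_eq[symmetric] mult.commute)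
  ultimately show ?thesis using False assms by (simp add: chain_weight_snoc)
qed

section \<open>The isometry for forms in independent Wiener increments\<close>

definition cell_increment :: "(nat \<Rightarrow> real \<Rightarrow> 'w \<Rightarrow> real) \<Rightarrow> real \<Rightarrow> real \<Rightarrow> 'w \<Rightarrow> nat \<Rightarrow> nat \<Rightarrow> real" where
  "cell_increment W s \<delta> \<omega> a k = W a (s + real (k + 1) * \<delta>) \<omega> - W a (s + real k * \<delta>) \<omega>"

lemma cell_increment_block:
  "(\<Sum>k\<in>{j*R..<Suc j*R}. cell_increment W s \<delta> \<omega> a k) = cell_increment W s (real R * \<delta>) \<omega> a j"
proof -
  have "(\<Sum>k\<in>{j*R..<Suc j*R}. cell_increment W s \<delta> \<omega> a k)
     = (\<Sum>k\<in>{j*R..<Suc j*R}. W a (s + real (Suc k) * \<delta>) \<omega> - W a (s + real k * \<delta>) \<omega>)"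
    by (simp add: cell_increment_def)
  also have "\<dots> = W a (s + real (Suc j*R) * \<delta>) \<omega> - W a (s + real (j*R) * \<delta>) \<omega>"
    by (rule sum_Suc_diff') simp
  also have "\<dots> = cell_increment W s (real R * \<delta>) \<omega> a j"
    by (simp add: cell_increment_def algebra_simps)
  finally show ?thesis .
qed

lemma multilinear_form_cell_increment_coarsen:
  assumes "finite S" "R > 0"
  shows "multilinear_form (cell_increment W s (real R * \<delta>) \<omega>) S n c =
         multilinear_form (cell_increment W s \<delta> \<omega>) S (n*R) (\<lambda>\<kappa>. c (restrict (\<lambda>a. \<kappa> a div R) S))"
  using multilinear_form_coarsen[OF assms, of "cell_increment W s \<delta> \<omega>" n c]
  by (simp only: cell_increment_block)

locale wiener = prob_space P for P :: "'w measure" +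
  fixes d :: nat and W :: "nat \<Rightarrow> real \<Rightarrow> 'w \<Rightarrow> real"
  assumes wiener: "wiener_process P d W"
begin

lemma W_measurable: "a \<in> {1..d} \<Longrightarrow> 0 \<le> t \<Longrightarrow> W a t \<in> borel_measurable P"
  using wiener by (auto simp: wiener_process_def)

lemma cell_increment_measurable:
  assumes "a \<in> {1..d}" "0 \<le> s" "0 \<le> \<delta>"
  shows "(\<lambda>\<omega>. cell_increment W s \<delta> \<omega> a k) \<in> borel_measurable P"
  unfolding cell_increment_def
  using assms by (intro borel_measurable_diff W_measurable) auto

lemma cell_increment_moments:
  assumes a: "a \<in> {1..d}" and "0 \<le> s" "0 \<le> \<delta>"
  shows "integrable P (\<lambda>\<omega>. cell_increment W s \<delta> \<omega> a k)"
    and "integrable P (\<lambda>\<omega>. (cell_increment W s \<delta> \<omega> a k)\<^sup>2)"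
    and "expectation (\<lambda>\<omega>. cell_increment W s \<delta> \<omega> a k) = 0"
    and "expectation (\<lambda>\<omega>. (cell_increment W s \<delta> \<omega> a k)\<^sup>2) = \<delta>"
proof -
  let ?X = "\<lambda>\<omega>. cell_increment W s \<delta> \<omega> a k"
  have "integrable P ?X \<and> integrable P (\<lambda>\<omega>. (?X \<omega>)\<^sup>2) \<and> expectation ?X = 0 \<and> expectation (\<lambda>\<omega>. (?X \<omega>)\<^sup>2) = \<delta>"
  proof (cases "\<delta> = 0")
    case True
    then show ?thesis by (simp add: cell_increment_def)
  next
    case False
    let ?u = "s + real k * \<delta>" and ?v = "s + real (k + 1) * \<delta>"
    have pos: "sqrt \<delta> > 0" using False assms by simp
    have "0 \<le> ?u" "?u < ?v" and vu: "?v - ?u = \<delta>" using assms False by (auto simp: algebra_simps)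
    moreover have "\<forall>s t. 0 \<le> s \<and> s < t \<longrightarrow>
        distributed P lborel (\<lambda>\<omega>. W a t \<omega> - W a s \<omega>) (normal_density 0 (sqrt (t - s)))"
      using wiener a unfolding wiener_process_def by blast
    ultimately have "distributed P lborel (\<lambda>\<omega>. W a ?v \<omega> - W a ?u \<omega>) (normal_density 0 (sqrt (?v - ?u)))"
      by blast
    then have D: "distributed P lborel ?X (normal_density 0 (sqrt \<delta>))"
      unfolding cell_increment_def vu .
    have int: "integrable P ?X"
      using distributed_integrable[OF D, of "\<lambda>x. x"] integrable_normal_moment_nz_1[OF pos, of 0] by simp
    have int2: "integrable P (\<lambda>\<omega>. (?X \<omega>)\<^sup>2)"
      using distributed_integrable[OF D, of "\<lambda>x. x\<^sup>2"] integrable_normal_moment[OF pos, of 0 2] by simp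
    have E: "expectation ?X = 0" by (rule normal_distributed_expectation[OF pos D])
    have "variance ?X = (sqrt \<delta>)\<^sup>2" by (rule normal_distributed_variance[OF pos D])
    then show ?thesis using int int2 E assms by simp
  qed
  then show "integrable P ?X" "integrable P (\<lambda>\<omega>. (?X \<omega>)\<^sup>2)" "expectation ?X = 0" "expectation (\<lambda>\<omega>. (?X \<omega>)\<^sup>2) = \<delta>"
    by auto
qed

lemma cell_increment_indep:
  assumes "0 \<le> s" "0 \<le> \<delta>"
  shows "indep_vars (\<lambda>_. borel) (\<lambda>(a, k) \<omega>. cell_increment W s \<delta> \<omega> a k) ({1..d} \<times> {..<n})"
proof -
  let ?\<tau> = "\<lambda>k. s + real k * \<delta>"
  have "0 \<le> ?\<tau> 0" "mono ?\<tau>" using assms by (auto intro!: monoI mult_right_mono)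
  moreover have "\<forall>\<tau> m. 0 \<le> \<tau> 0 \<and> mono (\<tau> :: nat \<Rightarrow> real) \<longrightarrow> indep_vars (\<lambda>_. borel)
      (\<lambda>(i, k) \<omega>. W i (\<tau> (Suc k)) \<omega> - W i (\<tau> k) \<omega>) ({1..d} \<times> {..<m})"
    using wiener unfolding wiener_process_def by blast
  ultimately have "indep_vars (\<lambda>_. borel) (\<lambda>(i, k) \<omega>. W i (?\<tau> (Suc k)) \<omega> - W i (?\<tau> k) \<omega>) ({1..d} \<times> {..<n})"
    by (auto dest!: spec[of _ ?\<tau>])
  then show ?thesis by (simp add: cell_increment_def)
qed

lemma cell_increment_products:
  assumes a: "a \<in> {1..d}" and "0 \<le> s" "0 \<le> \<delta>"
  shows "integrable P (\<lambda>\<omega>. cell_increment W s \<delta> \<omega> a j * cell_increment W s \<delta> \<omega> a k)" (is ?int)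
    and "expectation (\<lambda>\<omega>. cell_increment W s \<delta> \<omega> a j * cell_increment W s \<delta> \<omega> a k)
      = (if j = k then \<delta> else 0)" (is ?exp)
proof -
  have "?int \<and> ?exp"
  proof (cases "j = k")
    case True
    then show ?thesis
      using cell_increment_moments(2,4)[OF assms, of k] by (simp add: power2_eq_square)
  next
    case False
    let ?X = "\<lambda>(a, k) \<omega>. cell_increment W s \<delta> \<omega> a k"
    have "indep_vars (\<lambda>_. borel) ?X ({1..d} \<times> {..<Suc (max j k)})"
      by (rule cell_increment_indep[OF assms(2,3)])
    then have "indep_var (PiM {(a,j)} (\<lambda>_. borel)) (\<lambda>\<omega>. restrict (\<lambda>i. ?X i \<omega>) {(a,j)})
       (PiM {(a,k)} (\<lambda>_. borel)) (\<lambda>\<omega>. restrict (\<lambda>i. ?X i \<omega>) {(a,k)})"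
      by (rule indep_var_restrict) (use a False in auto)
    then have "indep_var borel ((\<lambda>f. f (a,j)) \<circ> (\<lambda>\<omega>. restrict (\<lambda>i. ?X i \<omega>) {(a,j)}))
       borel ((\<lambda>f. f (a,k)) \<circ> (\<lambda>\<omega>. restrict (\<lambda>i. ?X i \<omega>) {(a,k)}))"
      by (rule indep_var_compose) (auto intro: measurable_component_singleton)
    then have "indep_var borel (\<lambda>\<omega>. cell_increment W s \<delta> \<omega> a j) borel (\<lambda>\<omega>. cell_increment W s \<delta> \<omega> a k)"
      by (simp add: comp_def)
    note indep_var_lebesgue_integral[OF this] indep_var_integrable[OF this]
    then show ?thesis using cell_increment_moments[OF assms] False by simp
  qed
  then show ?int ?exp by auto
qed

text \<open>
  Group the product of the two monomials by components: the groups are independent, and within a group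
  two different cells of the same component have uncorrelated increments.
\<close>

lemma monomial_products:
  assumes S: "S \<subseteq> {1..d}" and "0 \<le> s" "0 \<le> \<delta>"
    and \<kappa>: "\<kappa> \<in> PiE S (\<lambda>_. {..<n})" "\<kappa>' \<in> PiE S (\<lambda>_. {..<n})"
  defines "X \<equiv> \<lambda>a k \<omega>. cell_increment W s \<delta> \<omega> a k"
  shows "integrable P (\<lambda>\<omega>. (\<Prod>a\<in>S. X a (\<kappa> a) \<omega>) * (\<Prod>a\<in>S. X a (\<kappa>' a) \<omega>))" (is ?int)
    and "expectation (\<lambda>\<omega>. (\<Prod>a\<in>S. X a (\<kappa> a) \<omega>) * (\<Prod>a\<in>S. X a (\<kappa>' a) \<omega>))
      = (if \<kappa> = \<kappa>' then \<delta> ^ card S else 0)" (is ?exp)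
proof -
  let ?Z = "\<lambda>a \<omega>. X a (\<kappa> a) \<omega> * X a (\<kappa>' a) \<omega>"
  have fin: "finite S" using S finite_subset by blast
  have "indep_vars (\<lambda>_. borel) (\<lambda>(a, k) \<omega>. X a k \<omega>) ({1..d} \<times> {..<n})"
    unfolding X_def by (rule cell_increment_indep[OF assms(2,3)])
  then have "indep_vars (\<lambda>a. PiM ({a} \<times> {..<n}) (\<lambda>_. borel))
      (\<lambda>a \<omega>. restrict (\<lambda>i. (case i of (a, k) \<Rightarrow> \<lambda>\<omega>. X a k \<omega>) \<omega>) ({a} \<times> {..<n})) S"
    by (rule indep_vars_restrict) (use S in \<open>auto simp: disjoint_family_on_def\<close>)
  then have "indep_vars (\<lambda>_. borel)
      (\<lambda>a \<omega>. (\<lambda>f. (f (a, \<kappa> a) :: real) * f (a, \<kappa>' a)) (restrict (\<lambda>i. (case i of (a, k) \<Rightarrow> \<lambda>\<omega>. X a k \<omega>) \<omega>) ({a} \<times> {..<n}))) S"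
  proof (rule indep_vars_compose2)
    fix a assume "a \<in> S"
    then have *: "(a, \<kappa> a) \<in> {a} \<times> {..<n}" "(a, \<kappa>' a) \<in> {a} \<times> {..<n}" using \<kappa> by auto
    show "(\<lambda>f. (f (a, \<kappa> a) :: real) * f (a, \<kappa>' a)) \<in> borel_measurable (PiM ({a} \<times> {..<n}) (\<lambda>_. borel))"
      by (rule borel_measurable_times[OF *[THEN measurable_component_singleton]])
  qed
  also have "?this \<longleftrightarrow> indep_vars (\<lambda>_. borel) ?Z S"
    by (intro indep_vars_cong refl) (use \<kappa> in \<open>auto simp: fun_eq_iff PiE_iff\<close>)
  finally have ind: "indep_vars (\<lambda>_. borel) ?Z S" .
  have aS: "a \<in> {1..d}" if "a \<in> S" for a using S that by auto
  have int: "integrable P (?Z a)" if "a \<in> S" for a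
    unfolding X_def by (rule cell_increment_products[OF aS[OF that] assms(2,3)])
  have "(\<Prod>a\<in>S. expectation (?Z a)) = (\<Prod>a\<in>S. if \<kappa> a = \<kappa>' a then \<delta> else 0)"
    unfolding X_def by (intro prod.cong refl cell_increment_products aS assms)
  also have "\<dots> = (if \<kappa> = \<kappa>' then \<delta> ^ card S else 0)"
  proof (cases "\<kappa> = \<kappa>'")
    case False
    then obtain a where "a \<in> S" "\<kappa> a \<noteq> \<kappa>' a" using \<kappa> by (metis PiE_ext)
    then have "(\<Prod>a\<in>S. if \<kappa> a = \<kappa>' a then \<delta> else 0) = 0" using fin by (auto intro!: prod_zero)
    then show ?thesis using False by simp
  qed simp
  finally show ?exp
    using indep_vars_lebesgue_integral[OF fin ind int] by (simp add: prod.distrib)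
  show ?int
    using indep_vars_integrable[OF fin ind int] by (simp add: prod.distrib)
qed

text \<open>
  This is the discrete counterpart of the isometry of multiple Ito integrals.  It reduces every second
  moment below to counting index tuples.
\<close>

lemma multilinear_form_isometry:
  assumes S: "S \<subseteq> {1..d}" and "0 \<le> s" "0 \<le> \<delta>"
  shows "integrable P (\<lambda>\<omega>. (multilinear_form (cell_increment W s \<delta> \<omega>) S n c)\<^sup>2)" (is ?int)
    and "expectation (\<lambda>\<omega>. (multilinear_form (cell_increment W s \<delta> \<omega>) S n c)\<^sup>2)
      = \<delta> ^ card S * (\<Sum>\<kappa>\<in>PiE S (\<lambda>_. {..<n}). (c \<kappa>)\<^sup>2)" (is ?exp)
proof -
  let ?I = "PiE S (\<lambda>_. {..<n})"
  let ?m = "\<lambda>\<kappa> \<omega>. \<Prod>a\<in>S. cell_increment W s \<delta> \<omega> a (\<kappa> a)"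
  have fin: "finite ?I" using S finite_subset by (intro finite_PiE) blast+
  have eq: "(multilinear_form (cell_increment W s \<delta> \<omega>) S n c)\<^sup>2 = (\<Sum>\<kappa>\<in>?I. \<Sum>\<kappa>'\<in>?I. c \<kappa> * c \<kappa>' * (?m \<kappa> \<omega> * ?m \<kappa>' \<omega>))" for \<omega>
    by (simp add: multilinear_form_def power2_eq_square sum_product mult_ac)
  show ?int unfolding eq
    by (intro Bochner_Integration.integrable_sum integrable_mult_right monomial_products[OF assms]) auto
  have "expectation (\<lambda>\<omega>. (multilinear_form (cell_increment W s \<delta> \<omega>) S n c)\<^sup>2) =
     (\<Sum>\<kappa>\<in>?I. \<Sum>\<kappa>'\<in>?I. c \<kappa> * c \<kappa>' * expectation (\<lambda>\<omega>. ?m \<kappa> \<omega> * ?m \<kappa>' \<omega>))"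
    unfolding eq
    by (subst Bochner_Integration.integral_sum, 
        (intro Bochner_Integration.integrable_sum integrable_mult_right monomial_products[OF assms]; simp),
        intro sum.cong refl, subst Bochner_Integration.integral_sum,
        (intro Bochner_Integration.integrable_sum integrable_mult_right monomial_products[OF assms]; simp),
        simp)
  also have "\<dots> = (\<Sum>\<kappa>\<in>?I. \<Sum>\<kappa>'\<in>?I. c \<kappa> * c \<kappa>' * (if \<kappa> = \<kappa>' then \<delta> ^ card S else 0))"
    by (intro sum.cong refl arg_cong2[where f="(*)"] monomial_products[OF assms])
  also have "\<dots> = \<delta> ^ card S * (\<Sum>\<kappa>\<in>?I. (c \<kappa>)\<^sup>2)"
    using fin by (simp add: if_distrib[where f="(*) _"] sum.delta power2_eq_square sum_distrib_left mult_ac cong: if_cong)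
  finally show ?exp .
qed

lemma multilinear_form_measurable:
  assumes "S \<subseteq> {1..d}" and "0 \<le> s" "0 \<le> \<delta>"
  shows "(\<lambda>\<omega>. multilinear_form (cell_increment W s \<delta> \<omega>) S n c) \<in> borel_measurable P"
  unfolding multilinear_form_def using assms
  by (intro borel_measurable_sum borel_measurable_times borel_measurable_prod borel_measurable_const
      cell_increment_measurable) auto

end

section \<open>Mean-square bounds and almost sure limits\<close>

context prob_space begin

text \<open>
  Fatou's lemma.  It transfers explicit error bounds to limits whose integrability is not known in
  advance, as is the case for integrals that are given only as limits in probability.
\<close>

lemma second_moment_limit:
  fixes X :: "nat \<Rightarrow> 'a \<Rightarrow> real"
  assumes [measurable]: "\<And>n. X n \<in> borel_measurable M" "Z \<in> borel_measurable M"
    and lim: "AE \<omega> in M. (\<lambda>n. X n \<omega>) \<longlonglongrightarrow> Z \<omega>"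
    and bound: "\<And>n. integrable M (\<lambda>\<omega>. (X n \<omega>)\<^sup>2)" "\<And>n. expectation (\<lambda>\<omega>. (X n \<omega>)\<^sup>2) \<le> c"
  shows "integrable M (\<lambda>\<omega>. (Z \<omega>)\<^sup>2)" "expectation (\<lambda>\<omega>. (Z \<omega>)\<^sup>2) \<le> c"
proof -
  have c: "0 \<le> c" using bound(2)[of 0] by (rule order_trans[rotated]) simp
  have "(\<integral>\<^sup>+\<omega>. ennreal ((Z \<omega>)\<^sup>2) \<partial>M) = (\<integral>\<^sup>+\<omega>. liminf (\<lambda>n. ennreal ((X n \<omega>)\<^sup>2)) \<partial>M)"
  proof (rule nn_integral_cong_AE)
    show "AE \<omega> in M. ennreal ((Z \<omega>)\<^sup>2) = liminf (\<lambda>n. ennreal ((X n \<omega>)\<^sup>2))"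
      using lim
    proof eventually_elim
      case (elim \<omega>)
      then have "(\<lambda>n. ennreal ((X n \<omega>)\<^sup>2)) \<longlonglongrightarrow> ennreal ((Z \<omega>)\<^sup>2)"
        by (intro tendsto_ennrealI tendsto_power)
      then show ?case by (rule lim_imp_Liminf[OF trivial_limit_sequentially, symmetric])
    qed
  qed
  also have "\<dots> \<le> liminf (\<lambda>n. \<integral>\<^sup>+\<omega>. ennreal ((X n \<omega>)\<^sup>2) \<partial>M)"
    by (rule nn_integral_liminf) simp
  also have "\<dots> \<le> ennreal c"
  proof (rule Liminf_le)
    have "(\<integral>\<^sup>+\<omega>. ennreal ((X n \<omega>)\<^sup>2) \<partial>M) = ennreal (expectation (\<lambda>\<omega>. (X n \<omega>)\<^sup>2))" for n
      using bound(1) by (intro nn_integral_eq_integral) auto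
    then show "\<forall>\<^sub>F n in sequentially. (\<integral>\<^sup>+\<omega>. ennreal ((X n \<omega>)\<^sup>2) \<partial>M) \<le> ennreal c"
      using bound(2) by (simp add: ennreal_leI)
  qed simp
  finally have le: "(\<integral>\<^sup>+\<omega>. ennreal ((Z \<omega>)\<^sup>2) \<partial>M) \<le> ennreal c" .
  then have "(\<integral>\<^sup>+\<omega>. ennreal ((Z \<omega>)\<^sup>2) \<partial>M) < \<infinity>"
    by (rule order.strict_trans1) simp
  then show int: "integrable M (\<lambda>\<omega>. (Z \<omega>)\<^sup>2)"
    by (intro integrableI_nonneg) auto
  show "expectation (\<lambda>\<omega>. (Z \<omega>)\<^sup>2) \<le> c"
    using le c nn_integral_eq_integral[OF int] by simp
qed

text \<open>
  Borel-Cantelli, in the form in which convergence in probability along fast partitions is used.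
\<close>

lemma AE_tendsto_of_geometric_prob:
  fixes X :: "nat \<Rightarrow> 'a \<Rightarrow> real"
  assumes [measurable]: "\<And>n. X n \<in> borel_measurable M" "Z \<in> borel_measurable M"
    and small: "\<And>n. prob {\<omega> \<in> space M. \<bar>X n \<omega> - Z \<omega>\<bar> > (1/2)^n} < (1/2)^n"
  shows "AE \<omega> in M. (\<lambda>n. X n \<omega>) \<longlonglongrightarrow> Z \<omega>"
proof -
  let ?A = "\<lambda>n. {\<omega> \<in> space M. \<bar>X n \<omega> - Z \<omega>\<bar> > (1/2)^n}"
  have "summable (\<lambda>n. prob (?A n))"
    by (rule summable_comparison_test'[of "\<lambda>n. (1/2)^n" 0])
      (use small in \<open>auto intro!: less_imp_le summable_geometric\<close>)
  then have "AE \<omega> in M. \<forall>\<^sub>F n in sequentially. \<omega> \<in> space M - ?A n"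
    by (intro borel_cantelli_AE1) (auto simp: less_top[symmetric])
  then show ?thesis
  proof eventually_elim
    case (elim \<omega>)
    have "(\<lambda>n. X n \<omega> - Z \<omega>) \<longlonglongrightarrow> 0"
    proof (rule Lim_null_comparison)
      show "\<forall>\<^sub>F n in sequentially. norm (X n \<omega> - Z \<omega>) \<le> (1/2)^n"
        using elim by eventually_elim auto
      show "(\<lambda>n. (1/2::real)^n) \<longlonglongrightarrow> 0" by (simp add: LIMSEQ_power_zero)
    qed
    then show ?case by (simp add: LIM_zero_iff)
  qed
qed

text \<open>
  A single subsequence serves all of finitely many sequences at once, because it can be chosen for the
  sum of their squares.
\<close>

lemma AE_subseq_of_second_moments:
  fixes X :: "nat \<Rightarrow> nat \<Rightarrow> 'a \<Rightarrow> real"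
  assumes int: "\<And>n j. j \<in> I \<Longrightarrow> integrable M (\<lambda>\<omega>. (X n j \<omega>)\<^sup>2)"
    and lim: "\<And>j. j \<in> I \<Longrightarrow> (\<lambda>n. expectation (\<lambda>\<omega>. (X n j \<omega>)\<^sup>2)) \<longlonglongrightarrow> 0"
    and fin: "finite I"
  obtains \<rho> :: "nat \<Rightarrow> nat" where "strict_mono \<rho>" "AE \<omega> in M. \<forall>j\<in>I. (\<lambda>n. X (\<rho> n) j \<omega>) \<longlonglongrightarrow> 0"
proof -
  let ?u = "\<lambda>n \<omega>. \<Sum>j\<in>I. (X n j \<omega>)\<^sup>2"
  have "integrable M (?u n)" for n using int by auto
  moreover have "(\<lambda>n. \<integral>\<omega>. norm (?u n \<omega>) \<partial>M) \<longlonglongrightarrow> 0"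
  proof -
    have "(\<lambda>n. \<integral>\<omega>. norm (?u n \<omega>) \<partial>M) = (\<lambda>n. \<Sum>j\<in>I. expectation (\<lambda>\<omega>. (X n j \<omega>)\<^sup>2))"
      using int by (simp add: sum_nonneg)
    also have "\<dots> \<longlonglongrightarrow> 0" by (rule tendsto_null_sum[OF lim])
    finally show ?thesis .
  qed
  ultimately obtain \<rho> where \<rho>: "strict_mono \<rho>" "AE \<omega> in M. (\<lambda>n. ?u (\<rho> n) \<omega>) \<longlonglongrightarrow> 0"
    using tendsto_L1_AE_subseq[of M ?u] by blast
  have "AE \<omega> in M. \<forall>j\<in>I. (\<lambda>n. X (\<rho> n) j \<omega>) \<longlonglongrightarrow> 0"
    using \<rho>(2)
  proof eventually_elim
    case (elim \<omega>)
    show ?case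
    proof
      fix j assume j: "j \<in> I"
      have "(\<lambda>n. (X (\<rho> n) j \<omega>)\<^sup>2) \<longlonglongrightarrow> 0"
      proof (rule Lim_null_comparison[OF _ elim])
        have "(X (\<rho> n) j \<omega>)\<^sup>2 \<le> ?u (\<rho> n) \<omega>" for n
          using fin j by (intro member_le_sum) auto
        then show "\<forall>\<^sub>F n in sequentially. norm ((X (\<rho> n) j \<omega>)\<^sup>2) \<le> ?u (\<rho> n) \<omega>" by simp
      qed
      then have "(\<lambda>n. sqrt ((X (\<rho> n) j \<omega>)\<^sup>2)) \<longlonglongrightarrow> sqrt 0" by (rule tendsto_real_sqrt)
      then show "(\<lambda>n. X (\<rho> n) j \<omega>) \<longlonglongrightarrow> 0" by (simp add: tendsto_rabs_zero_iff)
    qed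
  qed
  with \<rho>(1) show thesis by (rule that)
qed

end

section \<open>Mean-square approximation of multiple Stratonovich integrals\<close>

text \<open>
  The iterated trapezoidal sum over the first \<open>n\<close> cells of width \<open>\<delta>\<close> after time \<open>s\<close>.
\<close>

definition grid_integral ::
    "(nat \<Rightarrow> real \<Rightarrow> 'w \<Rightarrow> real) \<Rightarrow> nat list \<Rightarrow> real \<Rightarrow> real \<Rightarrow> nat \<Rightarrow> 'w \<Rightarrow> real" where
  "grid_integral W \<alpha> s \<delta> n \<omega> = multilinear_form (cell_increment W s \<delta> \<omega>) (set \<alpha>) n (chain_weight \<alpha>)"

lemma grid_integral_degenerate:
  assumes "\<alpha> \<noteq> []"
  shows "grid_integral W \<alpha> s 0 n \<omega> = 0" "grid_integral W \<alpha> s \<delta> 0 \<omega> = 0"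
proof -
  have "finite (set \<alpha>)" "set \<alpha> \<noteq> {}" using assms by auto
  then have "(0::real) ^ card (set \<alpha>) = 0" by (simp add: card_gt_0_iff)
  then show "grid_integral W \<alpha> s 0 n \<omega> = 0"
    by (simp add: grid_integral_def multilinear_form_def cell_increment_def zero_power)
  show "grid_integral W \<alpha> s \<delta> 0 \<omega> = 0"
  proof -
    have "PiE (set \<alpha>) (\<lambda>_. {} :: nat set) = {}"
      using \<open>set \<alpha> \<noteq> {}\<close> by (simp add: PiE_eq_empty_iff ex_in_conv)
    then show ?thesis by (simp add: grid_integral_def multilinear_form_def)
  qed
qed

context wiener begin

lemma grid_integral_L2:
  assumes "set \<alpha> \<subseteq> {1..d}" "0 \<le> s" "0 \<le> \<delta>"
  shows "grid_integral W \<alpha> s \<delta> n \<in> borel_measurable P"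
    and "integrable P (\<lambda>\<omega>. (grid_integral W \<alpha> s \<delta> n \<omega>)\<^sup>2)"
  unfolding grid_integral_def using multilinear_form_measurable[OF assms] multilinear_form_isometry(1)[OF assms] by auto

text \<open>
  The bound does not involve \<open>r\<close> and \<open>R\<close>: the outer rule has \<open>K * r\<close> nodes and the inner integrals
  have resolution \<open>K * r * R\<close>, and the two limits \<open>R \<longlonglongrightarrow> \<infinity>\<close> (exact inner integrals) and then
  \<open>r \<longlonglongrightarrow> \<infinity>\<close> (exact outer integral) can be taken in the estimate.
\<close>

lemma trapezoid_of_grid_integrals:
  assumes dist: "distinct (\<alpha> @ [a])" and "\<alpha> \<noteq> []" and sub: "set (\<alpha> @ [a]) \<subseteq> {1..d}"
    and "0 \<le> s" "0 \<le> h" "K \<ge> 1" "r \<ge> 1" "R \<ge> 1"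
  defines "\<delta> \<equiv> h / real (K * r * R)"
  defines "D \<equiv> \<lambda>\<omega>. (\<Sum>j<K*r. (grid_integral W \<alpha> s \<delta> (j*R) \<omega> + grid_integral W \<alpha> s \<delta> (Suc j*R) \<omega>) / 2
         * cell_increment W s (real R * \<delta>) \<omega> a j) - grid_integral W (\<alpha> @ [a]) s (h / real K) K \<omega>"
  shows "integrable P (\<lambda>\<omega>. (D \<omega>)\<^sup>2)" "expectation (\<lambda>\<omega>. (D \<omega>)\<^sup>2) \<le> real (length \<alpha>) * h ^ Suc (length \<alpha>) / real K"
proof -
  let ?\<beta> = "\<alpha> @ [a]" and ?p = "r * R" and ?n = "K * (r * R)"
  let ?I = "PiE (set ?\<beta>) (\<lambda>_. {..<?n})"
  let ?c = "\<lambda>\<kappa>. chain_weight \<alpha> \<kappa> * step_weight (\<kappa> (last \<alpha>) div R) (\<kappa> a div R)"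
  let ?c' = "\<lambda>\<kappa>. chain_weight ?\<beta> (\<lambda>b. \<kappa> b div ?p)"
  have pos: "0 \<le> \<delta>" "R > 0" "?p > 0" using assms by (auto simp: \<delta>_def)
  have D: "D \<omega> = multilinear_form (cell_increment W s \<delta> \<omega>) (set ?\<beta>) ?n (\<lambda>\<kappa>. ?c \<kappa> - ?c' \<kappa>)" for \<omega>
  proof -
    have "h / real K = real ?p * \<delta>" using assms by (simp add: \<delta>_def)
    then have "grid_integral W ?\<beta> s (h / real K) K \<omega> =
      multilinear_form (cell_increment W s (real ?p * \<delta>) \<omega>) (set ?\<beta>) K (chain_weight ?\<beta>)"
      by (simp only: grid_integral_def)
    also have "\<dots> = multilinear_form (cell_increment W s \<delta> \<omega>) (set ?\<beta>) ?n
        (\<lambda>\<kappa>. chain_weight ?\<beta> (restrict (\<lambda>b. \<kappa> b div ?p) (set ?\<beta>)))"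
      by (rule multilinear_form_cell_increment_coarsen) (use pos in auto)
    also have "\<dots> = multilinear_form (cell_increment W s \<delta> \<omega>) (set ?\<beta>) ?n ?c'"
      by (intro multilinear_form_cong chain_weight_cong) auto
    finally have 1: "grid_integral W ?\<beta> s (h / real K) K \<omega> = \<dots>" .
    have "(\<Sum>j<K*r. (grid_integral W \<alpha> s \<delta> (j*R) \<omega> + grid_integral W \<alpha> s \<delta> (Suc j*R) \<omega>) / 2
         * cell_increment W s (real R * \<delta>) \<omega> a j) = multilinear_form (cell_increment W s \<delta> \<omega>) (set ?\<beta>) (K*r*R) ?c"
      unfolding grid_integral_def cell_increment_block[symmetric]
      by (rule multilinear_form_trapezoid) (use assms in auto)
    then show ?thesis unfolding D_def 1 by (simp only: multilinear_form_diff mult.assoc)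
  qed
  show "integrable P (\<lambda>\<omega>. (D \<omega>)\<^sup>2)"
    unfolding D by (rule multilinear_form_isometry(1)[OF sub assms(4) pos(1)])
  have fin: "finite ?I" by (intro finite_PiE) auto
  have "expectation (\<lambda>\<omega>. (D \<omega>)\<^sup>2) = \<delta> ^ card (set ?\<beta>) * (\<Sum>\<kappa>\<in>?I. (?c \<kappa> - ?c' \<kappa>)\<^sup>2)"
    unfolding D by (rule multilinear_form_isometry(2)[OF sub assms(4) pos(1)])
  also have "\<dots> \<le> \<delta> ^ card (set ?\<beta>) * (\<Sum>\<kappa>\<in>?I. if near_diagonal ?\<beta> ?p \<kappa> then 1 else 0)"
    by (intro mult_left_mono sum_mono trapezoid_coefficient_diff) (use assms pos in auto)
  also have "(\<Sum>\<kappa>\<in>?I. if near_diagonal ?\<beta> ?p \<kappa> then 1 else 0 :: real) = real (card {\<kappa>\<in>?I. near_diagonal ?\<beta> ?p \<kappa>})"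
    using fin by (simp add: sum.If_cases Int_def)
  also have "\<delta> ^ card (set ?\<beta>) * real (card {\<kappa>\<in>?I. near_diagonal ?\<beta> ?p \<kappa>})
     \<le> \<delta> ^ card (set ?\<beta>) * real ((length ?\<beta> - 1) * (?n ^ (length ?\<beta> - 1) * ?p))"
    by (intro mult_left_mono of_nat_mono card_near_diagonal) (use assms pos in auto)
  also have "card (set ?\<beta>) = Suc (length \<alpha>)" using distinct_card[OF dist] by simp
  also have "\<delta> ^ Suc (length \<alpha>) * real ((length ?\<beta> - 1) * (?n ^ (length ?\<beta> - 1) * ?p))
      = real (length \<alpha>) * (real ?n * \<delta>) ^ length \<alpha> * (real ?p * \<delta>)"
    by (simp add: power_mult_distrib mult_ac)
  also have "real ?n * \<delta> = h" using assms by (simp add: \<delta>_def)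
  also have "real ?p * \<delta> = h / real K" using assms by (simp add: \<delta>_def)
  finally show "expectation (\<lambda>\<omega>. (D \<omega>)\<^sup>2) \<le> real (length \<alpha>) * h ^ Suc (length \<alpha>) / real K"
    by (simp add: mult_ac)
qed

end

locale stratonovich = wiener +
  fixes J :: "nat list \<Rightarrow> real \<Rightarrow> real \<Rightarrow> 'a \<Rightarrow> real"
  assumes strat: "multiple_stratonovich P d W J"
begin

text \<open>
  The property that is carried through the induction over the indices.  It has to hold for all
  intervals, since the next integration evaluates \<open>J \<alpha> s\<close> at all nodes of a partition, and its
  constant vanishes for \<open>l = 1\<close>, where the approximation is exact.
\<close>

definition approximable :: "nat list \<Rightarrow> bool" where
  "approximable \<alpha> \<longleftrightarrow> (\<forall>s t K. 0 \<le> s \<longrightarrow> s \<le> t \<longrightarrow> K \<ge> 1 \<longrightarrow>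
     J \<alpha> s t \<in> borel_measurable P \<and>
     integrable P (\<lambda>\<omega>. (J \<alpha> s t \<omega> - grid_integral W \<alpha> s ((t - s) / real K) K \<omega>)\<^sup>2) \<and>
     expectation (\<lambda>\<omega>. (J \<alpha> s t \<omega> - grid_integral W \<alpha> s ((t - s) / real K) K \<omega>)\<^sup>2)
       \<le> (real (length \<alpha>) - 1) * (t - s) ^ length \<alpha> / real K)"

lemma approximable_singleton:
  assumes "a \<in> {1..d}"
  shows "approximable [a]"
  unfolding approximable_def
proof (intro allI impI)
  fix s t :: real and K :: nat assume "0 \<le> s" "s \<le> t" "K \<ge> 1"
  have "J [a] s t = (\<lambda>\<omega>. W a t \<omega> - W a s \<omega>)"
    using strat assms \<open>0 \<le> s\<close> \<open>s \<le> t\<close> by (auto simp: multiple_stratonovich_def)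
  moreover have "grid_integral W [a] s ((t - s) / real K) K \<omega> = W a t \<omega> - W a s \<omega>" for \<omega>
  proof -
    have "grid_integral W [a] s ((t - s) / real K) K \<omega> = (\<Sum>k<K. cell_increment W s ((t - s) / real K) \<omega> a k)"
      by (simp add: grid_integral_def multilinear_form_insert multilinear_form_empty)
    also have "\<dots> = cell_increment W s (t - s) \<omega> a 0"
      using cell_increment_block[where j=0 and R=K and W=W and \<delta>="(t - s) / real K"] \<open>K \<ge> 1\<close>
      by (simp add: lessThan_atLeast0)
    finally show ?thesis by (simp add: cell_increment_def)
  qed
  ultimately show "J [a] s t \<in> borel_measurable P \<and>
     integrable P (\<lambda>\<omega>. (J [a] s t \<omega> - grid_integral W [a] s ((t - s) / real K) K \<omega>)\<^sup>2) \<and>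
     expectation (\<lambda>\<omega>. (J [a] s t \<omega> - grid_integral W [a] s ((t - s) / real K) K \<omega>)\<^sup>2)
       \<le> (real (length [a]) - 1) * (t - s) ^ length [a] / real K"
    using assms \<open>0 \<le> s\<close> \<open>s \<le> t\<close> by (auto intro!: borel_measurable_diff W_measurable)
qed

text \<open>
  At the node \<open>j\<close> of an outer partition into \<open>m\<close> pieces, \<open>J \<alpha> s\<close> is approximated on one common grid
  of \<open>m * R\<close> cells, of which the first \<open>j * R\<close> are used.
\<close>

lemma approximable_on_subgrid:
  assumes "approximable \<alpha>" "\<alpha> \<noteq> []" "0 \<le> s" "0 \<le> h" "j \<le> m" "m \<ge> 1" "R \<ge> 1"
  defines "\<delta> \<equiv> h / real (m * R)"
  defines "E \<equiv> \<lambda>\<omega>. J \<alpha> s (s + real j * (h / real m)) \<omega> - grid_integral W \<alpha> s \<delta> (j * R) \<omega>"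
  shows "integrable P (\<lambda>\<omega>. (E \<omega>)\<^sup>2)"
    and "expectation (\<lambda>\<omega>. (E \<omega>)\<^sup>2) \<le> real (length \<alpha>) * h ^ length \<alpha> / real R"
proof -
  let ?t = "s + real j * (h / real m)"
  \<comment> \<open>for j = 0 both terms of E belong to an interval of length 0, and one empty cell represents it\<close>
  define K where "K = (if j = 0 then 1 else j * R)"
  have st: "s \<le> ?t" "K \<ge> 1" using assms by (auto simp: K_def)
  have E: "E = (\<lambda>\<omega>. J \<alpha> s ?t \<omega> - grid_integral W \<alpha> s ((?t - s) / real K) K \<omega>)"
  proof (cases "j = 0")
    case True
    then show ?thesis by (simp add: E_def grid_integral_degenerate[OF assms(2)])
  next
    case False
    then have "(?t - s) / real K = \<delta>" "K = j * R" using assms by (auto simp: K_def \<delta>_def)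
    then show ?thesis by (simp add: E_def)
  qed
  have approx: "integrable P (\<lambda>\<omega>. (E \<omega>)\<^sup>2)"
    "expectation (\<lambda>\<omega>. (E \<omega>)\<^sup>2) \<le> (real (length \<alpha>) - 1) * (?t - s) ^ length \<alpha> / real K"
    using assms(1,3) st unfolding approximable_def E by blast+
  show "integrable P (\<lambda>\<omega>. (E \<omega>)\<^sup>2)" by fact
  have "real j * (h / real m) \<le> real m * (h / real m)"
    using assms by (intro mult_right_mono) auto
  then have th: "0 \<le> ?t - s" "?t - s \<le> h" using assms by auto
  have "(real (length \<alpha>) - 1) * (?t - s) ^ length \<alpha> / real K \<le> real (length \<alpha>) * h ^ length \<alpha> / real R"
  proof (cases "j = 0")
    case True
    have "(?t - s) ^ length \<alpha> = 0" using True assms(2) by (simp add: zero_power)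
    moreover have "0 \<le> real (length \<alpha>) * h ^ length \<alpha> / real R" using assms by simp
    ultimately show ?thesis by (metis div_0 mult_zero_right)
  next
    case False
    then have "R \<le> K" by (simp add: K_def)
    then have "real R \<le> real K" by (simp only: of_nat_le_iff)
    moreover have "(?t - s) ^ length \<alpha> \<le> h ^ length \<alpha>" using th by (intro power_mono)
    ultimately show ?thesis using assms th
      by (intro frac_le mult_mono) auto
  qed
  then show "expectation (\<lambda>\<omega>. (E \<omega>)\<^sup>2) \<le> real (length \<alpha>) * h ^ length \<alpha> / real R"
    using approx(2) by simp
qed

text \<open>
  The limit \<open>R \<longlonglongrightarrow> \<infinity>\<close>: at the finitely many nodes the grid approximations converge almost surely
  along a common subsequence, and hence so do the trapezoidal sums that are built from them.
\<close>

lemma trapezoidal_sum_near_grid_integral: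
  assumes app: "approximable \<alpha>" and "\<alpha> \<noteq> []" and dist: "distinct (\<alpha> @ [a])"
    and sub: "set (\<alpha> @ [a]) \<subseteq> {1..d}"
    and sh: "0 \<le> s" "0 \<le> h" and Kr: "K \<ge> 1" "r \<ge> 1"
  defines "p \<equiv> \<lambda>j. s + real j * (h / real (K * r))"
  defines "D \<equiv> \<lambda>\<omega>. trapezoidal_sum (J \<alpha> s) (W a) (K * r) p \<omega> - grid_integral W (\<alpha> @ [a]) s (h / real K) K \<omega>"
  shows "integrable P (\<lambda>\<omega>. (D \<omega>)\<^sup>2)" "expectation (\<lambda>\<omega>. (D \<omega>)\<^sup>2) \<le> real (length \<alpha>) * h ^ Suc (length \<alpha>) / real K"
proof -
  let ?m = "K * r"
  let ?\<delta> = "\<lambda>R. h / real (?m * Suc R)"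
  let ?G = "\<lambda>R j \<omega>. grid_integral W \<alpha> s (?\<delta> R) (j * Suc R) \<omega>"
  have m: "?m \<ge> 1" using Kr by simp
  have pm: "0 \<le> p j" "s \<le> p j" for j using sh by (auto simp: p_def)
  have meas: "J \<alpha> s (p j) \<in> borel_measurable P" for j
    using app sh(1) pm[of j] unfolding approximable_def by blast
  have small: "integrable P (\<lambda>\<omega>. (J \<alpha> s (p j) \<omega> - ?G R j \<omega>)\<^sup>2)"
    "expectation (\<lambda>\<omega>. (J \<alpha> s (p j) \<omega> - ?G R j \<omega>)\<^sup>2) \<le> real (length \<alpha>) * h ^ length \<alpha> / real (Suc R)"
    if "j \<in> {..?m}" for j R
    using approximable_on_subgrid[OF app assms(2) sh, of j ?m "Suc R"] that m unfolding p_def by auto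
  have lim: "(\<lambda>R. expectation (\<lambda>\<omega>. (J \<alpha> s (p j) \<omega> - ?G R j \<omega>)\<^sup>2)) \<longlonglongrightarrow> 0" if "j \<in> {..?m}" for j
  proof (rule Lim_null_comparison)
    show "\<forall>\<^sub>F R in sequentially. norm (expectation (\<lambda>\<omega>. (J \<alpha> s (p j) \<omega> - ?G R j \<omega>)\<^sup>2))
        \<le> real (length \<alpha>) * h ^ length \<alpha> / real (Suc R)"
      using small(2)[OF that] by simp
    show "(\<lambda>R. real (length \<alpha>) * h ^ length \<alpha> / real (Suc R)) \<longlonglongrightarrow> 0"
      using tendsto_mult[OF tendsto_const LIMSEQ_inverse_real_of_nat, of "real (length \<alpha>) * h ^ length \<alpha>"]
      by (simp add: divide_inverse)
  qed
  obtain \<rho> where \<rho>: "strict_mono \<rho>"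
    "AE \<omega> in P. \<forall>j\<in>{..?m}. (\<lambda>n. J \<alpha> s (p j) \<omega> - ?G (\<rho> n) j \<omega>) \<longlonglongrightarrow> 0"
    using AE_subseq_of_second_moments[of "{..?m}" "\<lambda>R j \<omega>. J \<alpha> s (p j) \<omega> - ?G R j \<omega>", OF small(1) lim]
    by blast
  define D' where "D' = (\<lambda>R \<omega>. (\<Sum>j<?m. (?G R j \<omega> + ?G R (Suc j) \<omega>) / 2
      * cell_increment W s (real (Suc R) * ?\<delta> R) \<omega> a j) - grid_integral W (\<alpha> @ [a]) s (h / real K) K \<omega>)"
  have D': "integrable P (\<lambda>\<omega>. (D' R \<omega>)\<^sup>2)" "expectation (\<lambda>\<omega>. (D' R \<omega>)\<^sup>2) \<le> real (length \<alpha>) * h ^ Suc (length \<alpha>) / real K"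
    for R
    using trapezoid_of_grid_integrals[OF dist assms(2) sub sh Kr, of "Suc R"] unfolding D'_def by auto
  have inc: "W a (p (Suc j)) \<omega> - W a (p j) \<omega> = cell_increment W s (real (Suc R) * ?\<delta> R) \<omega> a j" for j \<omega> R
  proof -
    have "real (Suc R) * (h / (real ?m * real (Suc R))) = h / real ?m"
      by (subst mult.commute) (simp del: of_nat_Suc of_nat_mult)
    then have "real (Suc R) * ?\<delta> R = h / real ?m" by (simp only: of_nat_mult)
    then show ?thesis by (simp add: cell_increment_def p_def)
  qed
  have "AE \<omega> in P. (\<lambda>n. D' (\<rho> n) \<omega>) \<longlonglongrightarrow> D \<omega>"
    using \<rho>(2)
  proof eventually_elim
    case (elim \<omega>)
    have G: "(\<lambda>n. ?G (\<rho> n) j \<omega>) \<longlonglongrightarrow> J \<alpha> s (p j) \<omega>" if "j \<le> ?m" for j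
    proof -
      have "(\<lambda>n. J \<alpha> s (p j) \<omega> - (J \<alpha> s (p j) \<omega> - ?G (\<rho> n) j \<omega>)) \<longlonglongrightarrow> J \<alpha> s (p j) \<omega> - 0"
        using elim that by (intro tendsto_diff tendsto_const) auto
      then show ?thesis by simp
    qed
    have D'': "D' R \<omega> = (\<Sum>j<?m. (?G R j \<omega> + ?G R (Suc j) \<omega>) / 2 * (W a (p (Suc j)) \<omega> - W a (p j) \<omega>))
        - grid_integral W (\<alpha> @ [a]) s (h / real K) K \<omega>" for R
      unfolding D'_def inc[of _ \<omega> R] ..
    show ?case
      unfolding D'' D_def trapezoidal_sum_def
      by (intro tendsto_diff tendsto_sum tendsto_mult tendsto_divide tendsto_add tendsto_const G) auto
  qed
  moreover have "D' R \<in> borel_measurable P" for R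
  proof -
    have "0 \<le> ?\<delta> R" using sh by simp
    moreover have "set \<alpha> \<subseteq> {1..d}" "a \<in> {1..d}" using sub by auto
    ultimately show ?thesis using sh sub unfolding D'_def
      by (intro borel_measurable_diff borel_measurable_sum borel_measurable_times borel_measurable_divide
          borel_measurable_add grid_integral_L2 cell_increment_measurable borel_measurable_const) auto
  qed
  moreover have "D \<in> borel_measurable P"
    unfolding D_def trapezoidal_sum_def using sub sh pm
    by (intro borel_measurable_diff borel_measurable_sum borel_measurable_times borel_measurable_divide
        borel_measurable_add grid_integral_L2 W_measurable meas borel_measurable_const) auto
  ultimately show "integrable P (\<lambda>\<omega>. (D \<omega>)\<^sup>2)"
    "expectation (\<lambda>\<omega>. (D \<omega>)\<^sup>2) \<le> real (length \<alpha>) * h ^ Suc (length \<alpha>) / real K"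
    using second_moment_limit[of "\<lambda>n. D' (\<rho> n)" D, OF _ _ _ D'] by blast+
qed

text \<open>
  The limit \<open>r \<longlonglongrightarrow> \<infinity>\<close>: trapezoidal sums over equidistant partitions with a number of pieces
  divisible by \<open>K\<close> converge to the Stratonovich integral in probability, almost surely along a
  subsequence.
\<close>

lemma approximable_snoc:
  assumes app: "approximable \<alpha>" and "\<alpha> \<noteq> []" and dist: "distinct (\<alpha> @ [a])"
    and sub: "set (\<alpha> @ [a]) \<subseteq> {1..d}"
  shows "approximable (\<alpha> @ [a])"
  unfolding approximable_def
proof (intro allI impI)
  fix s t :: real and K :: nat assume s: "0 \<le> s" "s \<le> t" and K: "K \<ge> 1"
  let ?h = "t - s" and ?I = "J (\<alpha> @ [a]) s t"
  let ?p = "\<lambda>r j. s + real j * (?h / real (K * r))"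
  let ?T = "\<lambda>r. trapezoidal_sum (J \<alpha> s) (W a) (K * r) (?p r)"
  let ?G = "grid_integral W (\<alpha> @ [a]) s (?h / real K) K"
  have "set \<alpha> \<subseteq> {0..d}" "a \<in> {0..d}" using sub by auto
  then have "stratonovich_integral P (J \<alpha> s) (W a) s t ?I"
    using strat s assms(2) unfolding multiple_stratonovich_def by blast
  then have I: "?I \<in> borel_measurable P"
    and Y: "\<And>\<tau>. \<tau> \<in> {s..t} \<Longrightarrow> J \<alpha> s \<tau> \<in> borel_measurable P \<and> W a \<tau> \<in> borel_measurable P"
    and conv: "\<And>\<epsilon>. \<epsilon> > 0 \<Longrightarrow> \<exists>\<delta>>0. \<forall>m p. partition_finer \<delta> s t m p \<longrightarrow>
        prob {\<omega> \<in> space P. \<bar>trapezoidal_sum (J \<alpha> s) (W a) m p \<omega> - ?I \<omega>\<bar> > \<epsilon>} < \<epsilon>"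
    unfolding stratonovich_integral_def by simp_all
  have "\<exists>r\<ge>1. prob {\<omega> \<in> space P. \<bar>?T r \<omega> - ?I \<omega>\<bar> > (1/2)^n} < (1/2)^n" for n
  proof -
    obtain \<delta> where \<delta>: "\<delta> > 0" and *: "\<And>m p. partition_finer \<delta> s t m p \<Longrightarrow>
        prob {\<omega> \<in> space P. \<bar>trapezoidal_sum (J \<alpha> s) (W a) m p \<omega> - ?I \<omega>\<bar> > (1/2)^n} < (1/2)^n"
      using conv[of "(1/2)^n"] by auto
    obtain r where r: "?h / \<delta> < real r" using reals_Archimedean2 by blast
    moreover have "0 \<le> ?h / \<delta>" using s \<delta> by simp
    ultimately have r1: "r \<ge> 1" by (cases r) auto
    have "?h / real (K * r) \<le> ?h / real r"
      using r1 K s by (intro divide_left_mono) auto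
    also have "\<dots> < \<delta>" using r r1 \<delta> by (simp add: field_simps)
    finally have "?h / real (K * r) < \<delta>" .
    then have "partition_finer \<delta> s t (K * r) (?p r)"
    proof -
      have "?p r (Suc k) = ?p r k + ?h / real (K * r)" for k by (simp add: distrib_right add_divide_distrib)
      moreover have "0 \<le> ?h / real (K * r)" using s by simp
      moreover have "?p r (K * r) = t" using r1 K by simp
      ultimately show ?thesis
        using \<open>?h / real (K * r) < \<delta>\<close> unfolding partition_finer_def by auto
    qed
    from *[OF this] r1 show ?thesis by blast
  qed
  then have "\<forall>n. \<exists>r. r \<ge> 1 \<and> prob {\<omega> \<in> space P. \<bar>?T r \<omega> - ?I \<omega>\<bar> > (1/2)^n} < (1/2)^n" by blast
  from choice[OF this] obtain r where r: "\<And>n. r n \<ge> 1"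
    "\<And>n. prob {\<omega> \<in> space P. \<bar>?T (r n) \<omega> - ?I \<omega>\<bar> > (1/2)^n} < (1/2)^n"
    by blast
  have p: "?p (r n) j \<in> {s..t}" if "j \<le> K * r n" for j n
  proof -
    have "real j * (?h / real (K * r n)) \<le> real (K * r n) * (?h / real (K * r n))"
      using that s by (intro mult_right_mono) (simp_all only: of_nat_le_iff, simp)
    also have "\<dots> = ?h" using K r(1)[of n] by simp
    finally show ?thesis using s by simp
  qed
  have T: "?T (r n) \<in> borel_measurable P" for n
    unfolding trapezoidal_sum_def
    by (intro borel_measurable_sum borel_measurable_times borel_measurable_divide borel_measurable_diff
        borel_measurable_add borel_measurable_const conjunct1[OF Y] conjunct2[OF Y] p) auto
  have G: "?G \<in> borel_measurable P" using s K by (intro grid_integral_L2 sub) auto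
  have "AE \<omega> in P. (\<lambda>n. ?T (r n) \<omega>) \<longlonglongrightarrow> ?I \<omega>"
    by (rule AE_tendsto_of_geometric_prob[OF T I r(2)])
  then have lim: "AE \<omega> in P. (\<lambda>n. ?T (r n) \<omega> - ?G \<omega>) \<longlonglongrightarrow> ?I \<omega> - ?G \<omega>"
    by eventually_elim (intro tendsto_diff tendsto_const)
  have "0 \<le> ?h" using s by simp
  note bound = trapezoidal_sum_near_grid_integral[OF app assms(2) dist sub s(1) this K r(1)]
  have "integrable P (\<lambda>\<omega>. (?I \<omega> - ?G \<omega>)\<^sup>2)"
    "expectation (\<lambda>\<omega>. (?I \<omega> - ?G \<omega>)\<^sup>2) \<le> real (length \<alpha>) * ?h ^ Suc (length \<alpha>) / real K"
    by (rule second_moment_limit[OF borel_measurable_diff[OF T G] borel_measurable_diff[OF I G] lim bound])+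
  with I show "?I \<in> borel_measurable P \<and> integrable P (\<lambda>\<omega>. (?I \<omega> - ?G \<omega>)\<^sup>2) \<and>
    expectation (\<lambda>\<omega>. (?I \<omega> - ?G \<omega>)\<^sup>2) \<le> (real (length (\<alpha> @ [a])) - 1) * (t - s) ^ length (\<alpha> @ [a]) / real K"
    by simp
qed

lemma strong_approximation:
  assumes "\<alpha> \<noteq> []" "distinct \<alpha>" "set \<alpha> \<subseteq> {1..d}"
  shows "approximable \<alpha>"
  using assms
proof (induction \<alpha> rule: rev_induct)
  case (snoc a \<alpha>)
  show ?case
  proof (cases "\<alpha> = []")
    case True
    then show ?thesis using snoc.prems by (simp add: approximable_singleton)
  next
    case False
    then show ?thesis using snoc by (intro approximable_snoc) auto
  qed
qed simp

end

section \<open>Conditional expectations of square integrable variables\<close>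

definition square_integrable :: "'a measure \<Rightarrow> ('a \<Rightarrow> real) \<Rightarrow> bool" where
  "square_integrable M X \<longleftrightarrow> X \<in> borel_measurable M \<and> integrable M (\<lambda>\<omega>. (X \<omega>)\<^sup>2)"

lemma square_integrable_measurable: "square_integrable M X \<Longrightarrow> X \<in> borel_measurable M"
  and square_integrable_square: "square_integrable M X \<Longrightarrow> integrable M (\<lambda>\<omega>. (X \<omega>)\<^sup>2)"
  by (simp_all add: square_integrable_def)

lemma square_integrable_mult:
  assumes "square_integrable M X" "square_integrable M Y"
  shows "integrable M (\<lambda>\<omega>. X \<omega> * Y \<omega>)"
proof (rule Bochner_Integration.integrable_bound)
  show "integrable M (\<lambda>\<omega>. (X \<omega>)\<^sup>2 + (Y \<omega>)\<^sup>2)"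
    by (intro Bochner_Integration.integrable_add square_integrable_square assms)
  show "(\<lambda>\<omega>. X \<omega> * Y \<omega>) \<in> borel_measurable M"
    by (intro borel_measurable_times square_integrable_measurable assms)
  have "\<bar>x * y\<bar> \<le> x\<^sup>2 + y\<^sup>2" for x y :: real
  proof -
    have "2 * (x * y) \<le> x\<^sup>2 + y\<^sup>2" "- (2 * (x * y)) \<le> x\<^sup>2 + y\<^sup>2"
      using sum_squares_bound[of x y] sum_squares_bound[of "-x" y] by simp_all
    moreover have "0 \<le> x\<^sup>2 + y\<^sup>2" by simp
    ultimately show ?thesis by linarith
  qed
  then show "AE \<omega> in M. norm (X \<omega> * Y \<omega>) \<le> norm ((X \<omega>)\<^sup>2 + (Y \<omega>)\<^sup>2)" by simp
qed

lemma square_integrable_diff: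
  assumes "square_integrable M X" "square_integrable M Y"
  shows "square_integrable M (\<lambda>\<omega>. X \<omega> - Y \<omega>)"
proof -
  have "integrable M (\<lambda>\<omega>. (X \<omega>)\<^sup>2 + (Y \<omega>)\<^sup>2 - 2 * (X \<omega> * Y \<omega>))"
    by (intro Bochner_Integration.integrable_diff Bochner_Integration.integrable_add integrable_mult_right
        square_integrable_mult square_integrable_square assms)
  then have "integrable M (\<lambda>\<omega>. (X \<omega> - Y \<omega>)\<^sup>2)" by (simp add: power2_diff mult.assoc)
  then show ?thesis using assms by (auto simp: square_integrable_def)
qed

lemma Cauchy_Schwarz_integral:
  assumes X: "square_integrable M X" and Y: "square_integrable M Y"
  shows "\<bar>\<integral>\<omega>. X \<omega> * Y \<omega> \<partial>M\<bar> \<le> sqrt (\<integral>\<omega>. (X \<omega>)\<^sup>2 \<partial>M) * sqrt (\<integral>\<omega>. (Y \<omega>)\<^sup>2 \<partial>M)"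
proof -
  have [measurable]: "X \<in> borel_measurable M" "Y \<in> borel_measurable M"
    using assms by (auto simp: square_integrable_def)
  have XY: "integrable M (\<lambda>\<omega>. \<bar>X \<omega> * Y \<omega>\<bar>)" using square_integrable_mult[OF assms] by simp
  have 1: "(\<integral>\<^sup>+\<omega>. ennreal \<bar>X \<omega>\<bar> * ennreal \<bar>Y \<omega>\<bar> \<partial>M) = ennreal (\<integral>\<omega>. \<bar>X \<omega> * Y \<omega>\<bar> \<partial>M)"
    using nn_integral_eq_integral[OF XY] by (simp add: ennreal_mult[symmetric] abs_mult)
  have 2: "(\<integral>\<^sup>+\<omega>. (ennreal \<bar>Z \<omega>\<bar>)\<^sup>2 \<partial>M) = ennreal (\<integral>\<omega>. (Z \<omega>)\<^sup>2 \<partial>M)" if "square_integrable M Z" for Z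
    using nn_integral_eq_integral[OF square_integrable_square[OF that]]
    by (simp add: ennreal_power)
  have "ennreal ((\<integral>\<omega>. \<bar>X \<omega> * Y \<omega>\<bar> \<partial>M)\<^sup>2) \<le> ennreal ((\<integral>\<omega>. (X \<omega>)\<^sup>2 \<partial>M) * (\<integral>\<omega>. (Y \<omega>)\<^sup>2 \<partial>M))"
    using Cauchy_Schwarz_nn_integral[of "\<lambda>\<omega>. ennreal \<bar>X \<omega>\<bar>" M "\<lambda>\<omega>. ennreal \<bar>Y \<omega>\<bar>"]
    unfolding 1 2[OF X] 2[OF Y] by (simp add: ennreal_power ennreal_mult)
  then have "(\<integral>\<omega>. \<bar>X \<omega> * Y \<omega>\<bar> \<partial>M)\<^sup>2 \<le> (\<integral>\<omega>. (X \<omega>)\<^sup>2 \<partial>M) * (\<integral>\<omega>. (Y \<omega>)\<^sup>2 \<partial>M)"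
    by (subst (asm) ennreal_le_iff) auto
  then have "(\<integral>\<omega>. \<bar>X \<omega> * Y \<omega>\<bar> \<partial>M) \<le> sqrt (\<integral>\<omega>. (X \<omega>)\<^sup>2 \<partial>M) * sqrt (\<integral>\<omega>. (Y \<omega>)\<^sup>2 \<partial>M)"
    by (metis real_le_rsqrt real_sqrt_mult)
  moreover have "\<bar>\<integral>\<omega>. X \<omega> * Y \<omega> \<partial>M\<bar> \<le> (\<integral>\<omega>. \<bar>X \<omega> * Y \<omega>\<bar> \<partial>M)" by (rule integral_abs_bound)
  ultimately show ?thesis by linarith
qed

lemma tendsto_integral_product:
  assumes X: "\<And>n. square_integrable M (X n)" "square_integrable M X'"
    and Y: "\<And>n. square_integrable M (Y n)" "square_integrable M Y'"
    and limX: "(\<lambda>n. \<integral>\<omega>. (X n \<omega> - X' \<omega>)\<^sup>2 \<partial>M) \<longlonglongrightarrow> 0"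
    and limY: "(\<lambda>n. \<integral>\<omega>. (Y n \<omega> - Y' \<omega>)\<^sup>2 \<partial>M) \<longlonglongrightarrow> 0"
  shows "(\<lambda>n. \<integral>\<omega>. X n \<omega> * Y n \<omega> \<partial>M) \<longlonglongrightarrow> (\<integral>\<omega>. X' \<omega> * Y' \<omega> \<partial>M)"
proof -
  let ?n = "\<lambda>Z. sqrt (\<integral>\<omega>. (Z \<omega>)\<^sup>2 \<partial>M)"
  let ?x = "\<lambda>n \<omega>. X n \<omega> - X' \<omega>" and ?y = "\<lambda>n \<omega>. Y n \<omega> - Y' \<omega>"
  have x: "square_integrable M (?x n)" and y: "square_integrable M (?y n)" for n
    using X Y by (auto intro: square_integrable_diff)
  have eq: "(\<integral>\<omega>. X n \<omega> * Y n \<omega> \<partial>M) - (\<integral>\<omega>. X' \<omega> * Y' \<omega> \<partial>M)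
      = (\<integral>\<omega>. ?x n \<omega> * ?y n \<omega> \<partial>M) + (\<integral>\<omega>. X' \<omega> * ?y n \<omega> \<partial>M) + (\<integral>\<omega>. ?x n \<omega> * Y' \<omega> \<partial>M)" for n
  proof -
    have "(\<integral>\<omega>. X n \<omega> * Y n \<omega> \<partial>M) - (\<integral>\<omega>. X' \<omega> * Y' \<omega> \<partial>M) = (\<integral>\<omega>. X n \<omega> * Y n \<omega> - X' \<omega> * Y' \<omega> \<partial>M)"
      using X Y by (intro Bochner_Integration.integral_diff[symmetric] square_integrable_mult)
    also have "\<dots> = (\<integral>\<omega>. ?x n \<omega> * ?y n \<omega> + X' \<omega> * ?y n \<omega> + ?x n \<omega> * Y' \<omega> \<partial>M)"
      by (rule Bochner_Integration.integral_cong) (auto simp: algebra_simps)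
    also have "\<dots> = (\<integral>\<omega>. ?x n \<omega> * ?y n \<omega> \<partial>M) + (\<integral>\<omega>. X' \<omega> * ?y n \<omega> \<partial>M) + (\<integral>\<omega>. ?x n \<omega> * Y' \<omega> \<partial>M)"
      using square_integrable_mult[OF x y] square_integrable_mult[OF X(2) y] square_integrable_mult[OF x Y(2)]
      by simp
    finally show ?thesis .
  qed
  have "(\<lambda>n. (\<integral>\<omega>. X n \<omega> * Y n \<omega> \<partial>M) - (\<integral>\<omega>. X' \<omega> * Y' \<omega> \<partial>M)) \<longlonglongrightarrow> 0"
  proof (rule Lim_null_comparison)
    show "\<forall>\<^sub>F n in sequentially. norm ((\<integral>\<omega>. X n \<omega> * Y n \<omega> \<partial>M) - (\<integral>\<omega>. X' \<omega> * Y' \<omega> \<partial>M))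
        \<le> ?n (?x n) * ?n (?y n) + ?n X' * ?n (?y n) + ?n (?x n) * ?n Y'"
      unfolding eq real_norm_def
      using Cauchy_Schwarz_integral[OF x y] Cauchy_Schwarz_integral[OF X(2) y] Cauchy_Schwarz_integral[OF x Y(2)]
      by (intro always_eventually allI order_trans[OF abs_triangle_ineq] add_mono)
    have "(\<lambda>n. ?n (?x n) * ?n (?y n) + ?n X' * ?n (?y n) + ?n (?x n) * ?n Y') \<longlonglongrightarrow>
       sqrt 0 * sqrt 0 + ?n X' * sqrt 0 + sqrt 0 * ?n Y'"
      by (intro tendsto_intros limX limY)
    then show "(\<lambda>n. ?n (?x n) * ?n (?y n) + ?n X' * ?n (?y n) + ?n (?x n) * ?n Y') \<longlonglongrightarrow> 0" by simp
  qed
  then show ?thesis by (simp add: LIM_zero_iff)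
qed

context prob_space begin

lemma square_integrable_integrable:
  assumes "square_integrable M X" shows "integrable M X"
  using square_integrable_mult[OF assms, of "\<lambda>_. 1"] by (simp add: square_integrable_def)

lemma square_integrable_indicator: "A \<in> events \<Longrightarrow> square_integrable M (indicator A)"
proof -
  assume "A \<in> events"
  moreover have "(\<lambda>\<omega>. (indicator A \<omega> :: real)\<^sup>2) = indicator A" by (auto simp: indicator_def fun_eq_iff)
  ultimately show "square_integrable M (indicator A)"
    by (simp add: square_integrable_def less_top[symmetric])
qed

lemma real_cond_exp_square:
  assumes F: "subalgebra M F" and D: "square_integrable M D"
  shows "square_integrable M (real_cond_exp M F D)"
    and "expectation (\<lambda>\<omega>. (D \<omega> - real_cond_exp M F D \<omega>)\<^sup>2) \<le> expectation (\<lambda>\<omega>. (D \<omega>)\<^sup>2)"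
proof -
  interpret finite_measure_subalgebra M F by unfold_locales (rule F)
  let ?Y = "real_cond_exp M F D"
  note D1 = square_integrable_integrable[OF D] and D2 = square_integrable_square[OF D]
  have jensen: "AE \<omega> in M. (?Y \<omega>)\<^sup>2 \<le> real_cond_exp M F (\<lambda>\<omega>. (D \<omega>)\<^sup>2) \<omega>"
    by (rule real_cond_exp_jensens_inequality(2)[where X=D and I=UNIV and q="\<lambda>x. x\<^sup>2"]) (use D1 D2 convex_power2 in auto)
  have "integrable M (\<lambda>\<omega>. (?Y \<omega>)\<^sup>2)"
  proof (rule Bochner_Integration.integrable_bound)
    show "integrable M (real_cond_exp M F (\<lambda>\<omega>. (D \<omega>)\<^sup>2))" by (rule real_cond_exp_int(1)[OF D2])
    show "AE \<omega> in M. norm ((?Y \<omega>)\<^sup>2) \<le> norm (real_cond_exp M F (\<lambda>\<omega>. (D \<omega>)\<^sup>2) \<omega>)"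
      using jensen by eventually_elim simp
  qed simp
  then show Y: "square_integrable M ?Y" by (simp add: square_integrable_def)
  have YD: "integrable M (\<lambda>\<omega>. ?Y \<omega> * D \<omega>)" by (rule square_integrable_mult[OF Y D])
  have "expectation (\<lambda>\<omega>. ?Y \<omega> * ?Y \<omega>) = expectation (\<lambda>\<omega>. ?Y \<omega> * D \<omega>)"
    by (rule real_cond_exp_intg(2)[OF YD]) (use square_integrable_measurable[OF D] in auto)
  moreover have "expectation (\<lambda>\<omega>. (D \<omega> - ?Y \<omega>)\<^sup>2) = expectation (\<lambda>\<omega>. (D \<omega>)\<^sup>2 + ?Y \<omega> * ?Y \<omega> - 2 * (?Y \<omega> * D \<omega>))"
    by (rule Bochner_Integration.integral_cong) (auto simp: power2_eq_square algebra_simps)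
  ultimately have "expectation (\<lambda>\<omega>. (D \<omega> - ?Y \<omega>)\<^sup>2) = expectation (\<lambda>\<omega>. (D \<omega>)\<^sup>2) - expectation (\<lambda>\<omega>. ?Y \<omega> * ?Y \<omega>)"
    using D2 YD square_integrable_mult[OF Y Y] by simp
  moreover have "0 \<le> expectation (\<lambda>\<omega>. ?Y \<omega> * ?Y \<omega>)" by simp
  ultimately show "expectation (\<lambda>\<omega>. (D \<omega> - ?Y \<omega>)\<^sup>2) \<le> expectation (\<lambda>\<omega>. (D \<omega>)\<^sup>2)" by linarith
qed

text \<open>
  Subtracting the observable \<open>Z\<close> from \<open>X\<close> does not change the error of the conditional expectation,
  and the error of a variable is never larger than the variable itself.
\<close>

lemma real_cond_exp_best_approximation:
  assumes F: "subalgebra M F" and X: "square_integrable M X" and Z: "square_integrable M Z" "Z \<in> borel_measurable F"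
  shows "expectation (\<lambda>\<omega>. (X \<omega> - real_cond_exp M F X \<omega>)\<^sup>2) \<le> expectation (\<lambda>\<omega>. (X \<omega> - Z \<omega>)\<^sup>2)"
proof -
  interpret finite_measure_subalgebra M F by unfold_locales (rule F)
  let ?D = "\<lambda>\<omega>. X \<omega> - Z \<omega>"
  have D: "square_integrable M ?D" by (rule square_integrable_diff[OF X Z(1)])
  have int: "integrable M X" "integrable M Z" using X Z by (auto intro: square_integrable_integrable)
  have "AE \<omega> in M. real_cond_exp M F ?D \<omega> = real_cond_exp M F X \<omega> - Z \<omega>"
    using real_cond_exp_diff[OF int] real_cond_exp_F_meas[OF int(2) Z(2)] by eventually_elim simp
  then have "expectation (\<lambda>\<omega>. (X \<omega> - real_cond_exp M F X \<omega>)\<^sup>2) = expectation (\<lambda>\<omega>. (?D \<omega> - real_cond_exp M F ?D \<omega>)\<^sup>2)"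
    using D X Z by (intro integral_cong_AE) (auto simp: square_integrable_def)
  also have "\<dots> \<le> expectation (\<lambda>\<omega>. (?D \<omega>)\<^sup>2)" by (rule real_cond_exp_square(2)[OF F D])
  finally show ?thesis .
qed

lemma indep_set_expectation_mult:
  fixes U V :: "'a \<Rightarrow> real"
  assumes ind: "indep_set (sets G) (sets H)" and sub: "subalgebra M G" "subalgebra M H"
    and U: "U \<in> borel_measurable G" "integrable M U" and V: "V \<in> borel_measurable H" "integrable M V"
  shows "expectation (\<lambda>\<omega>. U \<omega> * V \<omega>) = expectation U * expectation V"
proof (rule indep_var_lebesgue_integral[OF _ U(2) V(2)])
  have sp: "space G = space M" "space H = space M" using sub by (auto simp: subalgebra_def)
  have 1: "sigma_sets (space M) {U -` A \<inter> space M | A. A \<in> sets borel} \<subseteq> sets G"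
    using measurable_sets[OF U(1)] unfolding sp(1)[symmetric] by (intro sets.sigma_sets_subset) auto
  have 2: "sigma_sets (space M) {V -` A \<inter> space M | A. A \<in> sets borel} \<subseteq> sets H"
    using measurable_sets[OF V(1)] unfolding sp(2)[symmetric] by (intro sets.sigma_sets_subset) auto
  show "indep_var borel U borel V"
    unfolding indep_var_eq
  proof (intro conjI)
    show "U \<in> borel_measurable M" "V \<in> borel_measurable M" using U V by auto
    show "indep_set (sigma_sets (space M) {U -` A \<inter> space M |A. A \<in> sets borel})
       (sigma_sets (space M) {V -` A \<inter> space M |A. A \<in> sets borel})"
      using ind 1 2 unfolding indep_sets2_eq by blast
  qed
qed

text \<open>
  The events of the enlarged algebra are generated by the intersections \<open>a \<inter> b\<close>, which are stable under
  intersection, and on these both sides have the same integral.  The factorization hypothesis says that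
  \<open>X\<close>, cut off to an event \<open>a\<close>, is uncorrelated with every \<open>b\<close>.  It is used in place of the measurability of \<open>X\<close> with
  respect to an algebra independent of \<open>B\<close>, because it passes to \<open>L\<^sup>2\<close> limits without any completion
  of algebras by null sets.
\<close>

lemma real_cond_exp_irrelevant_information:
  fixes X :: "'a \<Rightarrow> real"
  assumes A: "A \<subseteq> events" and B: "B \<subseteq> events"
    and X: "integrable M X"
    and ind: "indep_set (sets (sigma (space M) A)) (sets (sigma (space M) B))"
    and fact: "\<And>a b. a \<in> sets (sigma (space M) A) \<Longrightarrow> b \<in> sets (sigma (space M) B) \<Longrightarrow>
       expectation (\<lambda>\<omega>. X \<omega> * indicator a \<omega> * indicator b \<omega>) = expectation (\<lambda>\<omega>. X \<omega> * indicator a \<omega>) * prob b"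
  shows "AE \<omega> in M. real_cond_exp M (sigma (space M) (A \<union> B)) X \<omega> = real_cond_exp M (sigma (space M) A) X \<omega>"
proof -
  let ?G = "sigma (space M) A" and ?H = "sigma (space M) B" and ?F = "sigma (space M) (A \<union> B)"
  have pow: "A \<subseteq> Pow (space M)" "B \<subseteq> Pow (space M)" using A B sets.space_closed by blast+
  have sub: "subalgebra M ?G" "subalgebra M ?H" "subalgebra M ?F"
    using A B pow by (auto simp: subalgebra_def sets.sigma_sets_subset intro!: sets.sigma_sets_subset)
  interpret G: finite_measure_subalgebra M ?G by unfold_locales (rule sub)
  interpret F: finite_measure_subalgebra M ?F by unfold_locales (rule sub)
  let ?Y = "real_cond_exp M ?G X"
  have Y: "integrable M ?Y" by (rule G.real_cond_exp_int(1)[OF X])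
  let ?E = "{a \<inter> b | a b. a \<in> sets ?G \<and> b \<in> sets ?H}"
  have GF: "sets ?G \<subseteq> sets ?F" using pow by (simp add: sigma_sets_mono')
  have EM: "?E \<subseteq> events" using sub by (auto simp: subalgebra_def)
  have gen: "sets ?F \<subseteq> sigma_sets (space M) ?E"
  proof -
    have "A \<union> B \<subseteq> ?E"
    proof
      fix c assume "c \<in> A \<union> B"
      then have "(c \<in> sets ?G \<and> space M \<in> sets ?H \<and> c = c \<inter> space M) \<or>
          (space M \<in> sets ?G \<and> c \<in> sets ?H \<and> c = space M \<inter> c)"
        using pow sets.top[of ?G] sets.top[of ?H] by auto
      then show "c \<in> ?E" by blast
    qed
    then have "sigma_sets (space M) (A \<union> B) \<subseteq> sigma_sets (space M) ?E" by (rule sigma_sets_mono')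
    then show ?thesis using pow by simp
  qed
  have stable: "Int_stable ?E"
  proof (rule Int_stableI)
    fix c c' assume "c \<in> ?E" "c' \<in> ?E"
    then obtain a b a' b' where "a \<in> sets ?G" "b \<in> sets ?H" "a' \<in> sets ?G" "b' \<in> sets ?H"
      "c = a \<inter> b" "c' = a' \<inter> b'" by blast
    then have "c \<inter> c' = (a \<inter> a') \<inter> (b \<inter> b')" "a \<inter> a' \<in> sets ?G" "b \<inter> b' \<in> sets ?H" by auto
    then show "c \<inter> c' \<in> ?E" by blast
  qed
  have "?E \<subseteq> Pow (space M)" using EM sets.space_closed by blast
  have "(\<integral>\<omega>\<in>C. X \<omega> \<partial>M) = (\<integral>\<omega>\<in>C. ?Y \<omega> \<partial>M)" if "C \<in> sigma_sets (space M) ?E" for C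
    using stable \<open>?E \<subseteq> Pow (space M)\<close> that
  proof (induction rule: sigma_sets_induct_disjoint)
    case (basic c)
    then obtain a b where ab: "a \<in> sets ?G" "b \<in> sets ?H" "c = a \<inter> b" by blast
    have M: "a \<in> events" "b \<in> events" using ab sub by (auto simp: subalgebra_def)
    have ind_ab: "(indicator (a \<inter> b) \<omega> :: real) = indicator a \<omega> * indicator b \<omega>" for \<omega> by (simp add: indicator_def)
    have "(\<integral>\<omega>\<in>c. X \<omega> \<partial>M) = expectation (\<lambda>\<omega>. X \<omega> * indicator a \<omega>) * prob b"
      using fact[OF ab(1,2)] by (simp add: set_lebesgue_integral_def ab(3) ind_ab mult_ac)
    also have "expectation (\<lambda>\<omega>. X \<omega> * indicator a \<omega>) = expectation (\<lambda>\<omega>. ?Y \<omega> * indicator a \<omega>)"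
      using G.real_cond_exp_intA[OF X ab(1)] by (simp add: set_lebesgue_integral_def mult_ac)
    also have "prob b = expectation (indicator b)" using M by simp
    also have "expectation (\<lambda>\<omega>. ?Y \<omega> * indicator a \<omega>) * expectation (indicator b)
      = expectation (\<lambda>\<omega>. ?Y \<omega> * indicator a \<omega> * indicator b \<omega>)"
      by (rule indep_set_expectation_mult[OF ind sub(1,2), symmetric])
        (use ab M Y square_integrable_integrable[OF square_integrable_indicator[OF M(2)]] in
          \<open>auto intro: integrable_real_mult_indicator\<close>)
    also have "\<dots> = (\<integral>\<omega>\<in>c. ?Y \<omega> \<partial>M)"
      by (simp add: set_lebesgue_integral_def ab(3) ind_ab mult_ac)
    finally show ?case .
  next
    case empty
    show ?case by (simp add: set_lebesgue_integral_def)
  next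
    case (compl c)
    have cM: "c \<in> events" using compl.hyps sets.sigma_sets_subset[OF EM] by blast
    have split: "(\<integral>\<omega>\<in>space M - c. Z \<omega> \<partial>M) = expectation Z - (\<integral>\<omega>\<in>c. Z \<omega> \<partial>M)" if "integrable M Z" for Z :: "'a \<Rightarrow> real"
    proof -
      have "(\<integral>\<omega>\<in>space M - c. Z \<omega> \<partial>M) = expectation (\<lambda>\<omega>. Z \<omega> - indicator c \<omega> * Z \<omega>)"
        unfolding set_lebesgue_integral_def by (rule Bochner_Integration.integral_cong) (auto simp: indicator_def)
      then show ?thesis
        using that cM integrable_mult_indicator[OF cM that] by (simp add: set_lebesgue_integral_def)
    qed
    show ?case using split[OF X] split[OF Y] compl G.real_cond_exp_int(2)[OF X] by simp
  next
    case (union c)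
    have cM: "c i \<in> events" for i using union.hyps sets.sigma_sets_subset[OF EM] by blast
    have "(\<integral>\<omega>\<in>(\<Union>i. c i). Z \<omega> \<partial>M) = (\<Sum>i. \<integral>\<omega>\<in>c i. Z \<omega> \<partial>M)" if "integrable M Z" for Z :: "'a \<Rightarrow> real"
    proof (rule lebesgue_integral_countable_add)
      show "c i \<inter> c j = {}" if "i \<noteq> j" for i j using union.hyps that by (auto simp: disjoint_family_on_def)
      show "set_integrable M (\<Union>i. c i) Z"
        unfolding set_integrable_def using cM that by (intro integrable_mult_indicator) auto
    qed (rule cM)
    then show ?case using X Y union by simp
  qed
  moreover have "?Y \<in> borel_measurable ?F"
    by (rule measurable_from_subalg[of ?F ?G]) (use GF pow in \<open>auto simp: subalgebra_def space_measure_of\<close>)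
  ultimately show ?thesis
    using gen X Y by (intro F.real_cond_exp_charact) blast+
qed

end

section \<open>Localization and orthogonality of the errors\<close>

definition cell_events ::
    "'w measure \<Rightarrow> nat \<Rightarrow> (nat \<Rightarrow> real \<Rightarrow> 'w \<Rightarrow> real) \<Rightarrow> real \<Rightarrow> nat set \<Rightarrow> 'w set set" where
  "cell_events P d W \<delta> A = (\<Union>i\<in>{1..d}. \<Union>k\<in>A.
     {(\<lambda>\<omega>. cell_increment W 0 \<delta> \<omega> i k) -` B \<inter> space P | B. B \<in> sets borel})"

text \<open>
  The \<open>\<sigma>\<close>-algebra of the increments over the cells with numbers in \<open>A\<close>, on one grid of width \<open>\<delta>\<close>
  that starts at \<open>0\<close>.  Numbering all cells consecutively turns disjointness of time intervals into
  disjointness of sets of numbers.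
\<close>

definition cell_algebra ::
    "'w measure \<Rightarrow> nat \<Rightarrow> (nat \<Rightarrow> real \<Rightarrow> 'w \<Rightarrow> real) \<Rightarrow> real \<Rightarrow> nat set \<Rightarrow> 'w measure" where
  "cell_algebra P d W \<delta> A = sigma (space P) (cell_events P d W \<delta> A)"

lemma cell_events_pow: "cell_events P d W \<delta> A \<subseteq> Pow (space P)"
  by (auto simp: cell_events_def)

lemma space_cell_algebra [simp]: "space (cell_algebra P d W \<delta> A) = space P"
  by (simp add: cell_algebra_def space_measure_of[OF cell_events_pow])

lemma sets_cell_algebra: "sets (cell_algebra P d W \<delta> A) = sigma_sets (space P) (cell_events P d W \<delta> A)"
  by (simp add: cell_algebra_def sets_measure_of[OF cell_events_pow])

lemma cell_events_Un: "cell_events P d W \<delta> (A \<union> B) = cell_events P d W \<delta> A \<union> cell_events P d W \<delta> B"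
  by (auto simp: cell_events_def)

lemma cell_increment_in_cell_algebra:
  assumes "i \<in> {1..d}" "k \<in> A"
  shows "(\<lambda>\<omega>. cell_increment W 0 \<delta> \<omega> i k) \<in> borel_measurable (cell_algebra P d W \<delta> A)"
proof (rule measurableI)
  fix B :: "real set" assume "B \<in> sets borel"
  then have "(\<lambda>\<omega>. cell_increment W 0 \<delta> \<omega> i k) -` B \<inter> space P \<in> cell_events P d W \<delta> A"
    unfolding cell_events_def using assms by blast
  then show "(\<lambda>\<omega>. cell_increment W 0 \<delta> \<omega> i k) -` B \<inter> space (cell_algebra P d W \<delta> A) \<in> sets (cell_algebra P d W \<delta> A)"
    by (auto simp: sets_cell_algebra)
qed simp

text \<open>
  A coarse increment is the sum of the fine increments in its cell.
\<close>

lemma cell_algebra_refine: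
  assumes "R > 0"
  shows "sets (cell_algebra P d W (real R * \<delta>) A) \<subseteq> sets (cell_algebra P d W \<delta> {k. k div R \<in> A})"
proof -
  let ?F = "cell_algebra P d W \<delta> {k. k div R \<in> A}"
  have "(\<lambda>\<omega>. cell_increment W 0 (real R * \<delta>) \<omega> i j) \<in> borel_measurable ?F"
    if "i \<in> {1..d}" "j \<in> A" for i j
    unfolding cell_increment_block[symmetric]
  proof (intro borel_measurable_sum cell_increment_in_cell_algebra that(1))
    fix k assume "k \<in> {j*R..<Suc j*R}"
    then have "k div R = j" using assms by (metis atLeastLessThan_iff mult.commute div_nat_eqI)
    then show "k \<in> {k. k div R \<in> A}" using that by simp
  qed
  then have "cell_events P d W (real R * \<delta>) A \<subseteq> sets ?F"
    unfolding cell_events_def using measurable_sets[of _ ?F borel] by fastforce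
  then show ?thesis
    unfolding sets_cell_algebra[of P d W "real R * \<delta>"] 
    using sets.sigma_sets_subset[of "cell_events P d W (real R * \<delta>) A" ?F] by simp
qed

lemma increment_algebra_eq_cell_algebra:
  "increment_algebra P d W T N Q = cell_algebra P d W (step_size T N / real Q) {..<N*Q}"
proof (cases "Q = 0")
  case True
  then show ?thesis by (simp add: increment_algebra_def cell_algebra_def cell_events_def)
next
  case False
  let ?\<delta> = "step_size T N / real Q"
  have inc: "increment W T N Q i n q = (\<lambda>\<omega>. cell_increment W 0 ?\<delta> \<omega> i (n*Q + q))" for i n q
  proof -
    have "grid T N n + real (q + 1) * ?\<delta> = 0 + real (n*Q + q + 1) * ?\<delta>"
      "grid T N n + real q * ?\<delta> = 0 + real (n*Q + q) * ?\<delta>"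
      using False by (simp_all add: grid_def field_simps)
    then show ?thesis by (intro ext) (simp only: increment_def cell_increment_def Let_def)
  qed
  have range: "k < N * Q \<longleftrightarrow> (\<exists>n<N. \<exists>q<Q. k = n*Q + q)" for k
  proof
    assume "k < N*Q"
    then have "k div Q < N" "k mod Q < Q" "k = k div Q * Q + k mod Q"
      using False by (auto simp: div_less_iff_less_mult)
    then show "\<exists>n<N. \<exists>q<Q. k = n*Q + q" by blast
  next
    assume "\<exists>n<N. \<exists>q<Q. k = n*Q + q"
    then obtain n q where nq: "n < N" "q < Q" "k = n*Q+q" by blast
    then have "k < n*Q + Q" by simp
    also have "n*Q + Q = Suc n * Q" by simp
    also have "Suc n * Q \<le> N * Q" using nq(1) by (intro mult_le_mono1) simp
    finally show "k < N*Q" .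
  qed
  have cells: "{..<N*Q} = (\<Union>n\<in>{..<N}. \<Union>q\<in>{..<Q}. {n*Q + q})"
    unfolding set_eq_iff lessThan_iff range by blast
  have "(\<Union>i\<in>{1..d}. \<Union>n\<in>{..<N}. \<Union>q\<in>{..<Q}. {increment W T N Q i n q -` B \<inter> space P | B. B \<in> sets borel})
     = cell_events P d W ?\<delta> {..<N*Q}"
    unfolding inc cell_events_def cells
    by (simp only: UN_UN_flatten UN_insert UN_empty Un_empty_right)
  then show ?thesis by (simp only: increment_algebra_def cell_algebra_def)
qed

lemma grid_integral_in_cell_algebra:
  assumes "set \<alpha> \<subseteq> {1..d}" "{k0..<k0+n} \<subseteq> A"
  shows "grid_integral W \<alpha> (real k0 * \<delta>) \<delta> n \<in> borel_measurable (cell_algebra P d W \<delta> A)"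
proof -
  have shift: "cell_increment W (real k0 * \<delta>) \<delta> \<omega> a k = cell_increment W 0 \<delta> \<omega> a (k0 + k)" for \<omega> a k
    by (simp add: cell_increment_def algebra_simps)
  have "grid_integral W \<alpha> (real k0 * \<delta>) \<delta> n = (\<lambda>\<omega>. \<Sum>\<kappa>\<in>PiE (set \<alpha>) (\<lambda>_. {..<n}).
      chain_weight \<alpha> \<kappa> * (\<Prod>a\<in>set \<alpha>. cell_increment W 0 \<delta> \<omega> a (k0 + \<kappa> a)))"
    by (simp add: fun_eq_iff grid_integral_def multilinear_form_def shift)
  also have "\<dots> \<in> borel_measurable (cell_algebra P d W \<delta> A)"
  proof (intro borel_measurable_sum borel_measurable_times borel_measurable_prod borel_measurable_const
      cell_increment_in_cell_algebra)
    fix \<kappa> a assume "\<kappa> \<in> PiE (set \<alpha>) (\<lambda>_. {..<n})" "a \<in> set \<alpha>"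
    then show "a \<in> {1..d}" "k0 + \<kappa> a \<in> A" using assms by (auto simp: PiE_iff)
  qed
  finally show ?thesis .
qed

context wiener begin

lemma cell_events_sets: "0 \<le> \<delta> \<Longrightarrow> cell_events P d W \<delta> A \<subseteq> events"
  using measurable_sets[OF cell_increment_measurable[of _ 0 \<delta>]] by (fastforce simp: cell_events_def)

lemma cell_algebra_subalgebra: "0 \<le> \<delta> \<Longrightarrow> subalgebra P (cell_algebra P d W \<delta> A)"
  using sets.sigma_sets_subset[OF cell_events_sets] by (simp add: subalgebra_def sets_cell_algebra)

lemma cell_algebra_indep:
  assumes "0 \<le> \<delta>" "A \<inter> B = {}" "A \<subseteq> {..<m}" "B \<subseteq> {..<m}"
  shows "indep_set (sets (cell_algebra P d W \<delta> A)) (sets (cell_algebra P d W \<delta> B))"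
proof -
  let ?E = "\<lambda>(i, k). {(\<lambda>\<omega>. cell_increment W 0 \<delta> \<omega> i k) -` B \<inter> space P | B. B \<in> sets borel}"
  let ?I = "\<lambda>b. {1..d} \<times> (if b then A else B)"
  have "indep_sets ?E ({1..d} \<times> {..<m})"
    using cell_increment_indep[of 0 \<delta> m] assms(1) unfolding indep_vars_def2
    by (auto simp: case_prod_unfold)
  then have "indep_sets ?E (\<Union>b\<in>UNIV. ?I b)"
    by (rule indep_sets_mono_index[rotated]) (use assms in \<open>auto split: if_splits\<close>)
  then have "indep_sets (\<lambda>b. sigma_sets (space P) (\<Union>i\<in>?I b. ?E i)) UNIV"
  proof (rule indep_sets_collect_sigma)
    show "disjoint_family_on ?I UNIV" using assms(2) by (auto simp: disjoint_family_on_def)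
    show "Int_stable (?E i)" for i
    proof (cases i)
      case (Pair a k)
      show ?thesis unfolding Pair prod.case
      proof (rule Int_stableI)
        let ?X = "\<lambda>\<omega>. cell_increment W 0 \<delta> \<omega> a k"
        fix u v assume "u \<in> {?X -` B \<inter> space P | B. B \<in> sets borel}" "v \<in> {?X -` B \<inter> space P | B. B \<in> sets borel}"
        then obtain B C where "B \<in> sets borel" "C \<in> sets borel" "u = ?X -` B \<inter> space P" "v = ?X -` C \<inter> space P" by blast
        then have "u \<inter> v = ?X -` (B \<inter> C) \<inter> space P" "B \<inter> C \<in> sets borel" by auto
        then show "u \<inter> v \<in> {?X -` B \<inter> space P | B. B \<in> sets borel}" by blast
      qed
    qed
  qed
  moreover have "(\<Union>i\<in>?I b. ?E i) = cell_events P d W \<delta> (if b then A else B)" for b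
    by (auto simp: cell_events_def)
  ultimately have "indep_sets (\<lambda>b. sets (cell_algebra P d W \<delta> (if b then A else B))) UNIV"
    by (simp add: sets_cell_algebra)
  moreover have "(\<lambda>b. sets (cell_algebra P d W \<delta> (if b then A else B))) =
     case_bool (sets (cell_algebra P d W \<delta> A)) (sets (cell_algebra P d W \<delta> B))"
    by (auto simp: fun_eq_iff split: bool.split)
  ultimately show ?thesis by (simp add: indep_set_def)
qed

end

text \<open>
  In this locale \<open>\<Delta>\<close> is the length of a subinterval and \<open>block n\<close> the set of cells of the step \<open>n\<close>.
  \<open>J_step n\<close> is the integral over the step \<open>n\<close> and \<open>J_local n\<close> its conditional expectation given
  only the increments on this step.  \<open>J_grid R n\<close> approximates \<open>J_step n\<close> with every subinterval divided
  into \<open>R\<close> cells: for \<open>R = 1\<close> it is a function of the observed increments, and for \<open>R \<longlonglongrightarrow> \<infinity>\<close> it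
  transfers independence from increments to \<open>J_step n\<close>.
\<close>

locale quadrature = stratonovich +
  fixes T :: real and N Q :: nat and \<alpha> :: "nat list"
  assumes T: "T > 0" and Q: "Q \<ge> 1"
    and \<alpha>: "\<alpha> \<noteq> []" "distinct \<alpha>" "set \<alpha> \<subseteq> {1..d}"
begin

definition "\<Delta> = step_size T N / real Q"

definition "block n = {n*Q..<n*Q+Q}"

definition "J_step n = J \<alpha> (grid T N n) (grid T N (n + 1))"

definition "J_grid R n = grid_integral W \<alpha> (grid T N n) (\<Delta> / real R) (Q*R)"

definition "J_local n = real_cond_exp P (cell_algebra P d W \<Delta> (block n)) (J_step n)"

lemma step_size_nonneg: "0 \<le> step_size T N" and grid_nonneg: "0 \<le> grid T N n"
  and \<Delta>_nonneg: "0 \<le> \<Delta>"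
  using T by (auto simp: step_size_def grid_def \<Delta>_def)

lemma J_grid_bound:
  assumes "R \<ge> 1"
  shows "J_step n \<in> borel_measurable P"
    and "integrable P (\<lambda>\<omega>. (J_step n \<omega> - J_grid R n \<omega>)\<^sup>2)"
    and "expectation (\<lambda>\<omega>. (J_step n \<omega> - J_grid R n \<omega>)\<^sup>2)
      \<le> (real (length \<alpha>) - 1) * step_size T N ^ length \<alpha> / real (Q * R)"
proof -
  let ?s = "grid T N n" and ?t = "grid T N (n+1)"
  have st: "?t - ?s = step_size T N" by (simp add: grid_def distrib_right)
  have "?s \<le> ?t" "Q * R \<ge> 1" using step_size_nonneg assms Q st by auto
  note app = strong_approximation[OF \<alpha>, unfolded approximable_def, rule_format, OF grid_nonneg this]
  have "\<Delta> / real R = (?t - ?s) / real (Q * R)" by (simp only: st) (simp add: \<Delta>_def)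
  then show "J_step n \<in> borel_measurable P"
    "integrable P (\<lambda>\<omega>. (J_step n \<omega> - J_grid R n \<omega>)\<^sup>2)"
    "expectation (\<lambda>\<omega>. (J_step n \<omega> - J_grid R n \<omega>)\<^sup>2)
      \<le> (real (length \<alpha>) - 1) * step_size T N ^ length \<alpha> / real (Q * R)"
    using app st unfolding J_step_def J_grid_def by simp_all
qed

lemma J_grid_square_integrable: "square_integrable P (J_grid R n)"
  unfolding square_integrable_def J_grid_def
  using \<Delta>_nonneg by (intro conjI grid_integral_L2 \<alpha> grid_nonneg) auto

lemma J_step_square_integrable: "square_integrable P (J_step n)"
proof -
  have "square_integrable P (\<lambda>\<omega>. J_grid 1 n \<omega> - J_step n \<omega>)"
    using J_grid_bound(1,2)[of 1 n] square_integrable_measurable[OF J_grid_square_integrable]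
    by (auto simp: square_integrable_def power2_commute[of "J_grid 1 n _"] simp del: One_nat_def)
  from square_integrable_diff[OF J_grid_square_integrable this, of 1 n] show ?thesis by simp
qed

lemma J_grid_tendsto: "(\<lambda>r. expectation (\<lambda>\<omega>. (J_grid (Suc r) n \<omega> - J_step n \<omega>)\<^sup>2)) \<longlonglongrightarrow> 0"
proof (rule Lim_null_comparison)
  let ?c = "(real (length \<alpha>) - 1) * step_size T N ^ length \<alpha> / real Q"
  have "expectation (\<lambda>\<omega>. (J_grid (Suc r) n \<omega> - J_step n \<omega>)\<^sup>2) \<le> ?c * inverse (real (Suc r))" for r
  proof -
    have "expectation (\<lambda>\<omega>. (J_grid (Suc r) n \<omega> - J_step n \<omega>)\<^sup>2)
        = expectation (\<lambda>\<omega>. (J_step n \<omega> - J_grid (Suc r) n \<omega>)\<^sup>2)"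
      by (simp only: power2_commute)
    also have "\<dots> \<le> ?c * inverse (real (Suc r))"
      using J_grid_bound(3)[of "Suc r" n]
      by (simp only: of_nat_mult divide_inverse inverse_mult_distrib mult.assoc)
    finally show ?thesis .
  qed
  then show "\<forall>\<^sub>F r in sequentially. norm (expectation (\<lambda>\<omega>. (J_grid (Suc r) n \<omega> - J_step n \<omega>)\<^sup>2))
      \<le> ?c * inverse (real (Suc r))" by simp
  show "(\<lambda>r. ?c * inverse (real (Suc r))) \<longlonglongrightarrow> 0"
    using tendsto_mult[OF tendsto_const LIMSEQ_inverse_real_of_nat, of ?c] by simp
qed

lemma J_grid_in_cell_algebra:
  assumes "R > 0"
  shows "J_grid R n \<in> borel_measurable (cell_algebra P d W (\<Delta> / real R) {k. k div R \<in> block n})"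
proof -
  have "grid T N n = real (n*Q*R) * (\<Delta> / real R)"
    using Q assms by (simp add: grid_def \<Delta>_def)
  moreover have "{n*Q*R..<n*Q*R + Q*R} \<subseteq> {k. k div R \<in> block n}"
    using assms by (auto simp: block_def less_eq_div_iff_mult_less_eq div_less_iff_less_mult distrib_right)
  ultimately show ?thesis
    using grid_integral_in_cell_algebra[OF \<alpha>(3), of "n*Q*R" "Q*R" _ W "\<Delta> / real R"]
    by (simp add: J_grid_def)
qed

lemma cell_algebra_block_refine:
  assumes "R > 0"
  shows "sets (cell_algebra P d W \<Delta> A) \<subseteq> sets (cell_algebra P d W (\<Delta> / real R) {k. k div R \<in> A})"
  using cell_algebra_refine[OF assms, of P d W "\<Delta> / real R" A] assms by simp

lemma refined_indep:
  assumes "R > 0" "A \<inter> B = {}" "A \<subseteq> {..<m}" "B \<subseteq> {..<m}"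
  shows "indep_set (sets (cell_algebra P d W (\<Delta> / real R) {k. k div R \<in> A}))
     (sets (cell_algebra P d W (\<Delta> / real R) {k. k div R \<in> B}))"
proof (rule cell_algebra_indep)
  show "0 \<le> \<Delta> / real R" using \<Delta>_nonneg by simp
  show "{k. k div R \<in> A} \<inter> {k. k div R \<in> B} = {}" using assms(2) by auto
  show "{k. k div R \<in> A} \<subseteq> {..<m*R}" "{k. k div R \<in> B} \<subseteq> {..<m*R}"
    using assms by (auto simp: div_less_iff_less_mult)
qed

lemma J_local_properties:
  shows "square_integrable P (J_local n)"
    and "expectation (J_local n) = expectation (J_step n)"
    and "J_local n \<in> borel_measurable (cell_algebra P d W \<Delta> (block n))"
proof -
  note sub = cell_algebra_subalgebra[OF \<Delta>_nonneg, of "block n"]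
  then interpret finite_measure_subalgebra P "cell_algebra P d W \<Delta> (block n)" by unfold_locales
  show "square_integrable P (J_local n)" "J_local n \<in> borel_measurable (cell_algebra P d W \<Delta> (block n))"
    unfolding J_local_def using real_cond_exp_square(1)[OF sub J_step_square_integrable] by auto
  show "expectation (J_local n) = expectation (J_step n)"
    unfolding J_local_def by (intro real_cond_exp_int square_integrable_integrable J_step_square_integrable)
qed

text \<open>
  For each \<open>R\<close> the fine increments on the step \<open>n\<close> determine \<open>J_grid R n\<close> and the observed increments
  on this step, and they are independent of the observed increments on the other steps.
\<close>

lemma cond_exp_is_local:
  assumes "n < N"
  shows "AE \<omega> in P. real_cond_exp P (increment_algebra P d W T N Q) (J_step n) \<omega> = J_local n \<omega>"
proof -
  let ?rest = "{..<N*Q} - block n"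
  have "Suc n * Q \<le> N * Q" using assms by (intro mult_le_mono1) simp
  then have blk: "block n \<subseteq> {..<N*Q}" by (auto simp: block_def)
  then have eq: "increment_algebra P d W T N Q = sigma (space P) (cell_events P d W \<Delta> (block n) \<union> cell_events P d W \<Delta> ?rest)"
    unfolding increment_algebra_eq_cell_algebra cell_algebra_def cell_events_Un[symmetric] \<Delta>_def[symmetric]
    by (simp add: Un_absorb1)
  show ?thesis
    unfolding eq J_local_def cell_algebra_def
  proof (rule real_cond_exp_irrelevant_information)
    show "integrable P (J_step n)" by (intro square_integrable_integrable J_step_square_integrable)
    show "indep_set (sets (sigma (space P) (cell_events P d W \<Delta> (block n)))) (sets (sigma (space P) (cell_events P d W \<Delta> ?rest)))"
      unfolding cell_algebra_def[symmetric] using \<Delta>_nonneg blk by (intro cell_algebra_indep[where m="N*Q"]) auto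
    fix a b assume "a \<in> sets (sigma (space P) (cell_events P d W \<Delta> (block n)))"
      "b \<in> sets (sigma (space P) (cell_events P d W \<Delta> ?rest))"
    then have ab: "a \<in> sets (cell_algebra P d W \<Delta> (block n))" "b \<in> sets (cell_algebra P d W \<Delta> ?rest)"
      by (simp_all add: cell_algebra_def)
    have M: "a \<in> events" "b \<in> events"
      using ab cell_algebra_subalgebra[OF \<Delta>_nonneg] by (auto simp: subalgebra_def)
    have prod: "expectation (\<lambda>\<omega>. J_grid R n \<omega> * indicator a \<omega> * indicator b \<omega>)
        = expectation (\<lambda>\<omega>. J_grid R n \<omega> * indicator a \<omega>) * prob b" if "R > 0" for R
    proof -
      let ?G = "cell_algebra P d W (\<Delta> / real R) {k. k div R \<in> block n}"
      let ?H = "cell_algebra P d W (\<Delta> / real R) {k. k div R \<in> ?rest}"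
      have "a \<in> sets ?G" "b \<in> sets ?H" using ab cell_algebra_block_refine[OF that] by blast+
      moreover have "subalgebra P ?G" "subalgebra P ?H" using \<Delta>_nonneg by (auto intro!: cell_algebra_subalgebra)
      moreover have "indep_set (sets ?G) (sets ?H)"
        using blk by (intro refined_indep[OF that, where m="N*Q"]) auto
      ultimately have "expectation (\<lambda>\<omega>. (J_grid R n \<omega> * indicator a \<omega>) * indicator b \<omega>)
        = expectation (\<lambda>\<omega>. J_grid R n \<omega> * indicator a \<omega>) * expectation (indicator b)"
        using M that
        by (intro indep_set_expectation_mult[of ?G ?H])
          (auto intro!: borel_measurable_times borel_measurable_indicator J_grid_in_cell_algebra square_integrable_integrable[OF square_integrable_indicator]
             square_integrable_mult J_grid_square_integrable square_integrable_indicator)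
      then show ?thesis using M by simp
    qed
    have lim: "(\<lambda>r. expectation (\<lambda>\<omega>. J_grid (Suc r) n \<omega> * indicator c \<omega>)) \<longlonglongrightarrow> expectation (\<lambda>\<omega>. J_step n \<omega> * indicator c \<omega>)"
      if "c \<in> events" for c
      using that by (intro tendsto_integral_product J_grid_tendsto J_grid_square_integrable
          J_step_square_integrable square_integrable_indicator) simp_all
    have ind_ab: "(indicator (a \<inter> b) \<omega> :: real) = indicator a \<omega> * indicator b \<omega>" for \<omega> by (simp add: indicator_def)
    have "(\<lambda>r. expectation (\<lambda>\<omega>. J_grid (Suc r) n \<omega> * indicator a \<omega> * indicator b \<omega>))
       \<longlonglongrightarrow> expectation (\<lambda>\<omega>. J_step n \<omega> * indicator a \<omega> * indicator b \<omega>)"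
      using lim[of "a \<inter> b"] M by (simp add: ind_ab mult.assoc)
    moreover have "(\<lambda>r. expectation (\<lambda>\<omega>. J_grid (Suc r) n \<omega> * indicator a \<omega> * indicator b \<omega>))
       \<longlonglongrightarrow> expectation (\<lambda>\<omega>. J_step n \<omega> * indicator a \<omega>) * prob b"
      unfolding prod[OF zero_less_Suc] by (intro tendsto_mult lim tendsto_const M)
    ultimately show "expectation (\<lambda>\<omega>. J_step n \<omega> * indicator a \<omega> * indicator b \<omega>)
       = expectation (\<lambda>\<omega>. J_step n \<omega> * indicator a \<omega>) * prob b"
      by (rule LIMSEQ_unique)
  qed (use \<Delta>_nonneg in \<open>auto intro!: cell_events_sets\<close>)
qed

text \<open>
  With \<open>J_grid R\<close> in place of \<open>J_step\<close> the two factors are functions of disjoint sets of fine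
  increments, so that the expectation of the product factors; the two means tend to \<open>0\<close>, as
  conditioning preserves the mean.
\<close>

lemma defects_orthogonal:
  assumes "n \<noteq> m"
  shows "expectation (\<lambda>\<omega>. (J_step n \<omega> - J_local n \<omega>) * (J_step m \<omega> - J_local m \<omega>)) = 0"
proof -
  let ?e = "\<lambda>R n \<omega>. J_grid R n \<omega> - J_local n \<omega>" and ?d = "\<lambda>n \<omega>. J_step n \<omega> - J_local n \<omega>"
  have L2: "square_integrable P (?e R n)" "square_integrable P (?d n)" for R n
    by (intro square_integrable_diff J_grid_square_integrable J_local_properties J_step_square_integrable)+
  have lim: "(\<lambda>r. expectation (\<lambda>\<omega>. (?e (Suc r) n \<omega> - ?d n \<omega>)\<^sup>2)) \<longlonglongrightarrow> 0" for n
    using J_grid_tendsto[of n] by simp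
  have prod: "expectation (\<lambda>\<omega>. ?e R n \<omega> * ?e R m \<omega>) = expectation (?e R n) * expectation (?e R m)" if "R > 0" for R
  proof -
    let ?G = "\<lambda>n. cell_algebra P d W (\<Delta> / real R) {k. k div R \<in> block n}"
    have sub: "subalgebra P (?G n)" for n using \<Delta>_nonneg by (auto intro!: cell_algebra_subalgebra)
    have meas: "?e R n \<in> borel_measurable (?G n)" for n
    proof (intro borel_measurable_diff J_grid_in_cell_algebra that)
      have "subalgebra (?G n) (cell_algebra P d W \<Delta> (block n))"
        using cell_algebra_block_refine[OF that] by (simp add: subalgebra_def)
      then show "J_local n \<in> borel_measurable (?G n)"
        by (rule measurable_from_subalg) (rule J_local_properties)
    qed
    have "block n \<inter> block m = {}"
    proof -
      have "Suc n * Q \<le> m * Q \<or> Suc m * Q \<le> n * Q" using assms by (meson mult_le_mono1 Suc_leI nat_neq_iff)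
      then show ?thesis by (auto simp: block_def)
    qed
    then have "indep_set (sets (?G n)) (sets (?G m))"
      by (intro refined_indep[OF that, where m="Suc (max n m) * Q"])
        (auto simp: block_def intro: order.strict_trans2)
    then show ?thesis
      by (rule indep_set_expectation_mult[OF _ sub sub meas _ meas])
        (intro square_integrable_integrable L2)+
  qed
  have mean: "(\<lambda>r. expectation (?e (Suc r) n)) \<longlonglongrightarrow> 0" for n
  proof -
    have "expectation (?d n) = 0"
      using J_local_properties(1,2) J_step_square_integrable
      by (subst Bochner_Integration.integral_diff) (auto intro: square_integrable_integrable)
    moreover have "(\<lambda>r. expectation (\<lambda>\<omega>. ?e (Suc r) n \<omega> * 1)) \<longlonglongrightarrow> expectation (\<lambda>\<omega>. ?d n \<omega> * 1)"
      by (intro tendsto_integral_product L2 lim) (auto simp: square_integrable_def)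
    ultimately show ?thesis by simp
  qed
  have "(\<lambda>r. expectation (\<lambda>\<omega>. ?e (Suc r) n \<omega> * ?e (Suc r) m \<omega>)) \<longlonglongrightarrow> expectation (\<lambda>\<omega>. ?d n \<omega> * ?d m \<omega>)"
    by (intro tendsto_integral_product L2 lim)
  moreover have "(\<lambda>r. expectation (\<lambda>\<omega>. ?e (Suc r) n \<omega> * ?e (Suc r) m \<omega>)) \<longlonglongrightarrow> 0"
    unfolding prod[OF zero_less_Suc] using tendsto_mult[OF mean mean] by simp
  ultimately show ?thesis by (rule LIMSEQ_unique)
qed

lemma increment_algebra_eq: "increment_algebra P d W T N Q = cell_algebra P d W \<Delta> {..<N*Q}"
  by (simp add: increment_algebra_eq_cell_algebra \<Delta>_def)

lemma increment_algebra_subalgebra: "subalgebra P (increment_algebra P d W T N Q)"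
  unfolding increment_algebra_eq by (rule cell_algebra_subalgebra[OF \<Delta>_nonneg])

lemma local_error_eq: "local_error P d W J T \<alpha> N Q n =
    (\<lambda>\<omega>. J_step n \<omega> - real_cond_exp P (increment_algebra P d W T N Q) (J_step n) \<omega>)"
  by (simp add: local_error_def J_step_def fun_eq_iff Let_def)

lemma local_error_square_integrable: "square_integrable P (local_error P d W J T \<alpha> N Q n)"
  unfolding local_error_eq
  by (intro square_integrable_diff real_cond_exp_square increment_algebra_subalgebra J_step_square_integrable)

text \<open>
  \<open>J_grid 1 n\<close> competes with the conditional expectation, which is the best approximation.
\<close>

lemma local_error_bound:
  assumes "n < N"
  shows "expectation (\<lambda>\<omega>. (local_error P d W J T \<alpha> N Q n \<omega>)\<^sup>2)
      \<le> (real (length \<alpha>) - 1) * step_size T N ^ length \<alpha> / real Q"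
proof -
  let ?F = "increment_algebra P d W T N Q"
  have "Suc n * Q \<le> N * Q" using assms by (intro mult_le_mono1) simp
  then have "block n \<subseteq> {..<N*Q}" by (auto simp: block_def)
  then have "sets (cell_algebra P d W \<Delta> (block n)) \<subseteq> sets ?F"
    unfolding increment_algebra_eq sets_cell_algebra by (intro sigma_sets_mono') (auto simp: cell_events_def)
  then have "subalgebra ?F (cell_algebra P d W \<Delta> (block n))" by (simp add: subalgebra_def increment_algebra_eq)
  then have "J_grid 1 n \<in> borel_measurable ?F"
    by (rule measurable_from_subalg) (use J_grid_in_cell_algebra[of 1 n] in simp)
  then have "expectation (\<lambda>\<omega>. (local_error P d W J T \<alpha> N Q n \<omega>)\<^sup>2) \<le> expectation (\<lambda>\<omega>. (J_step n \<omega> - J_grid 1 n \<omega>)\<^sup>2)"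
    unfolding local_error_eq
    by (rule real_cond_exp_best_approximation[OF increment_algebra_subalgebra J_step_square_integrable J_grid_square_integrable])
  then show ?thesis using J_grid_bound(3)[of 1 n] by simp
qed

lemma global_error_square:
  "(global_error P d W J T \<alpha> N Q)\<^sup>2 = (\<Sum>n<N. expectation (\<lambda>\<omega>. (local_error P d W J T \<alpha> N Q n \<omega>)\<^sup>2))"
proof -
  let ?e = "local_error P d W J T \<alpha> N Q"
  have orth: "expectation (\<lambda>\<omega>. ?e n \<omega> * ?e m \<omega>) = (if n = m then expectation (\<lambda>\<omega>. (?e n \<omega>)\<^sup>2) else 0)"
    if "n < N" "m < N" for n m
  proof (cases "n = m")
    case False
    have "AE \<omega> in P. ?e n \<omega> * ?e m \<omega> = (J_step n \<omega> - J_local n \<omega>) * (J_step m \<omega> - J_local m \<omega>)"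
      using cond_exp_is_local[OF that(1)] cond_exp_is_local[OF that(2)]
      by eventually_elim (simp add: local_error_def J_step_def Let_def)
    then have "expectation (\<lambda>\<omega>. ?e n \<omega> * ?e m \<omega>)
       = expectation (\<lambda>\<omega>. (J_step n \<omega> - J_local n \<omega>) * (J_step m \<omega> - J_local m \<omega>))"
      by (intro integral_cong_AE borel_measurable_times borel_measurable_diff square_integrable_measurable
          local_error_square_integrable J_step_square_integrable J_local_properties)
    then show ?thesis using defects_orthogonal[OF False] False by simp
  qed (simp add: power2_eq_square)
  have int: "integrable P (\<lambda>\<omega>. ?e n \<omega> * ?e m \<omega>)" for n m
    by (intro square_integrable_mult local_error_square_integrable)
  have "(global_error P d W J T \<alpha> N Q)\<^sup>2 = expectation (\<lambda>\<omega>. (\<Sum>n<N. ?e n \<omega>)\<^sup>2)"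
    by (simp add: global_error_def L2_norm_rv_def)
  also have "\<dots> = expectation (\<lambda>\<omega>. \<Sum>n<N. \<Sum>m<N. ?e n \<omega> * ?e m \<omega>)"
    by (simp add: power2_eq_square sum_product)
  also have "\<dots> = (\<Sum>n<N. \<Sum>m<N. expectation (\<lambda>\<omega>. ?e n \<omega> * ?e m \<omega>))"
    using int by simp
  also have "\<dots> = (\<Sum>n<N. \<Sum>m<N. if n = m then expectation (\<lambda>\<omega>. (?e n \<omega>)\<^sup>2) else 0)"
    using orth by (intro sum.cong) auto
  also have "\<dots> = (\<Sum>n<N. expectation (\<lambda>\<omega>. (?e n \<omega>)\<^sup>2))" by (simp add: sum.delta)
  finally show ?thesis .
qed

end

section \<open>Orders in the step size\<close>

lemma step_size_eventually:
  assumes "T > 0" "e > 0"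
  shows "\<forall>\<^sub>F N in sequentially. N > 0 \<and> 0 < step_size T N \<and> step_size T N < e"
proof -
  have "(\<lambda>N. step_size T N) \<longlonglongrightarrow> 0"
    unfolding step_size_def by (rule lim_const_over_n)
  then have "\<forall>\<^sub>F N in sequentially. step_size T N < e" using assms(2) by (rule order_tendstoD)
  with eventually_gt_at_top[of 0] show ?thesis
    by eventually_elim (use assms in \<open>simp add: step_size_def\<close>)
qed

lemma effort_exponent_pos:
  assumes "l \<ge> 2" "M \<ge> real l / 2"
  shows "effort_exponent M l > 0"
proof -
  have "0 \<le> (real l - 1) * (2 * M + 1 - real l)" using assms by (intro mult_nonneg_nonneg) auto
  then show ?thesis by (simp add: effort_exponent_def)
qed

lemma effort_bigo:
  assumes T: "T > 0" and l: "l \<ge> 2"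
    and Q: "(\<lambda>N. real (Q N)) \<in> O(\<lambda>N. step_size T N powr (- (2 * M + 1 - real l)))"
    and U: "quadrature_effort l Q U"
  shows "U \<in> O(\<lambda>N. step_size T N powr (- effort_exponent M l))"
proof -
  let ?g = "2 * M + 1 - real l"
  have N: "(\<lambda>N. real N) \<in> O(\<lambda>N. step_size T N powr (-1))"
  proof (rule bigoI)
    show "\<forall>\<^sub>F N in sequentially. norm (real N) \<le> T * norm (step_size T N powr (-1))"
      using step_size_eventually[OF T zero_less_one]
      by eventually_elim (use T in \<open>simp add: powr_minus_divide step_size_def\<close>)
  qed
  have "U \<in> O(\<lambda>N. real (Q N) ^ (l - 1) * real N)" using U by (simp add: quadrature_effort_def)
  also have "(\<lambda>N. real (Q N) ^ (l - 1) * real N) \<in>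
      O(\<lambda>N. (step_size T N powr (- ?g)) ^ (l - 1) * step_size T N powr (-1))"
    by (intro landau_o.big.mult landau_o.big_power Q N)
  also have "(\<lambda>N. (step_size T N powr (- ?g)) ^ (l - 1) * step_size T N powr (-1)) \<in>
      O(\<lambda>N. step_size T N powr (- effort_exponent M l))"
  proof (rule bigoI[where c=1])
    show "\<forall>\<^sub>F N in sequentially. norm ((step_size T N powr (- ?g)) ^ (l - 1) * step_size T N powr (-1))
        \<le> 1 * norm (step_size T N powr (- effort_exponent M l))"
      using step_size_eventually[OF T zero_less_one]
    proof eventually_elim
      case (elim N)
      let ?h = "step_size T N"
      have "(?h powr (- ?g)) ^ (l - 1) = ?h powr (- ?g * real (l - 1))"
        using elim by (simp add: powr_realpow[symmetric] powr_powr)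
      then have "(?h powr (- ?g)) ^ (l - 1) * ?h powr (-1) = ?h powr (- ?g * real (l - 1) + -1)"
        by (simp only: powr_add)
      also have "- ?g * real (l - 1) + -1 = - effort_exponent M l"
        using l by (simp add: effort_exponent_def of_nat_diff algebra_simps)
      finally show ?case by simp
    qed
  qed
  finally show ?thesis .
qed

text \<open>
  Negative powers reverse an inequality: an upper bound of the effort by a power of the step size is
  an upper bound of the step size by a power of the effort.
\<close>

lemma step_size_bigo_effort:
  assumes T: "T > 0" and M: "M > 0" and b: "b > 0"
    and pos: "\<forall>\<^sub>F N in sequentially. U N > 0"
    and U: "U \<in> O(\<lambda>N. step_size T N powr (- b))"
  shows "(\<lambda>N. step_size T N powr M) \<in> O(\<lambda>N. U N powr (- M / b))"
proof -
  obtain C where C: "C > 0" "\<forall>\<^sub>F N in sequentially. norm (U N) \<le> C * norm (step_size T N powr (- b))"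
    using landau_o.bigE[OF U] by blast
  show ?thesis
  proof (rule bigoI)
    show "\<forall>\<^sub>F N in sequentially. norm (step_size T N powr M) \<le> C powr (M / b) * norm (U N powr (- M / b))"
      using C(2) pos step_size_eventually[OF T zero_less_one]
    proof eventually_elim
      case (elim N)
      let ?h = "step_size T N"
      have "(C * ?h powr (- b)) powr (- M / b) \<le> U N powr (- M / b)"
        using elim M b by (intro powr_mono2') auto
      moreover have "(C * ?h powr (- b)) powr (- M / b) = C powr (- M / b) * ?h powr M"
        using C(1) elim b by (simp add: powr_mult powr_powr)
      ultimately have "C powr (M / b) * (C powr (- M / b) * ?h powr M) \<le> C powr (M / b) * U N powr (- M / b)"
        by (intro mult_left_mono) auto
      moreover have "C powr (M / b) * (C powr (- M / b) * ?h powr M) = ?h powr M"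
        using C(1) by (simp add: powr_add[symmetric] mult.assoc[symmetric])
      ultimately have "?h powr M \<le> C powr (M / b) * U N powr (- M / b)" by (simp only:)
      then show ?case by simp
    qed
  qed
qed

context stratonovich begin

lemma quadrature_errors:
  assumes T: "T > 0" and \<alpha>: "\<alpha> \<noteq> []" "distinct \<alpha>" "set \<alpha> \<subseteq> {1..d}" and q: "q \<ge> 1"
  shows "n < N \<Longrightarrow> (L2_norm_rv P (local_error P d W J T \<alpha> N q n))\<^sup>2
      \<le> (real (length \<alpha>) - 1) * step_size T N ^ length \<alpha> / real q"
    and "(global_error P d W J T \<alpha> N q)\<^sup>2 = (\<Sum>n<N. (L2_norm_rv P (local_error P d W J T \<alpha> N q n))\<^sup>2)"
proof -
  interpret quadrature P d W J T N q \<alpha> by unfold_locales (use assms in auto)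
  show "n < N \<Longrightarrow> (L2_norm_rv P (local_error P d W J T \<alpha> N q n))\<^sup>2
      \<le> (real (length \<alpha>) - 1) * step_size T N ^ length \<alpha> / real q"
    using local_error_bound by (simp add: L2_norm_rv_def)
  show "(global_error P d W J T \<alpha> N q)\<^sup>2 = (\<Sum>n<N. (L2_norm_rv P (local_error P d W J T \<alpha> N q n))\<^sup>2)"
    using global_error_square by (simp add: L2_norm_rv_def)
qed

lemma global_error_bigo:
  assumes T: "T > 0" and \<alpha>: "\<alpha> \<noteq> []" "distinct \<alpha>" "set \<alpha> \<subseteq> {1..d}" and Q: "\<And>N. Q N \<ge> 1"
    and err: "error_upto_order P d W J T \<alpha> Q M"
  shows "(\<lambda>N. global_error P d W J T \<alpha> N (Q N)) \<in> O(\<lambda>N. step_size T N powr M)"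
proof -
  obtain C where C: "C > 0" "\<forall>\<^sub>F N in sequentially. \<forall>n<N.
        L2_norm_rv P (local_error P d W J T \<alpha> N (Q N) n) \<le> C * step_size T N powr (M + 1/2)"
    using err unfolding error_upto_order_def by blast
  show ?thesis
  proof (rule bigoI)
    show "\<forall>\<^sub>F N in sequentially. norm (global_error P d W J T \<alpha> N (Q N)) \<le> (C * sqrt T) * norm (step_size T N powr M)"
      using C(2) step_size_eventually[OF T zero_less_one]
    proof eventually_elim
      case (elim N)
      let ?h = "step_size T N"
      have "(global_error P d W J T \<alpha> N (Q N))\<^sup>2 \<le> (\<Sum>n<N. (C * ?h powr (M + 1/2))\<^sup>2)"
        unfolding quadrature_errors(2)[OF T \<alpha> Q]
        using elim by (intro sum_mono power_mono) (auto simp: L2_norm_rv_def)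
      also have "\<dots> = C\<^sup>2 * (real N * ?h) * (?h powr M)\<^sup>2"
      proof -
        have "(?h powr (M + 1/2))\<^sup>2 = ?h powr (2 * M + 1)"
          by (simp add: power2_eq_square powr_add[symmetric])
        also have "\<dots> = (?h powr M)\<^sup>2 * ?h"
          using elim powr_add[of ?h "2 * M" 1] powr_add[of ?h M M] by (simp add: power2_eq_square)
        finally show ?thesis by (simp add: power_mult_distrib)
      qed
      also have "real N * ?h = T" using elim by (simp add: step_size_def)
      also have "C\<^sup>2 * T * (?h powr M)\<^sup>2 = (C * sqrt T * ?h powr M)\<^sup>2"
        using T by (simp add: power_mult_distrib)
      finally have "\<bar>global_error P d W J T \<alpha> N (Q N)\<bar> \<le> \<bar>C * sqrt T * ?h powr M\<bar>"
        by (simp only: abs_le_square_iff)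
      then show ?case using C(1) T by (simp add: abs_mult)
    qed
  qed
qed

lemma effort_and_error:
  assumes T: "T > 0" and l: "length \<alpha> = l" "l \<ge> 2" and M: "M \<ge> real l / 2"
    and \<alpha>: "distinct \<alpha>" "set \<alpha> \<subseteq> {1..d}" and Q: "\<And>N. Q N \<ge> 1"
    and err: "error_upto_order P d W J T \<alpha> Q M"
    and Q_bigo: "(\<lambda>N. real (Q N)) \<in> O(\<lambda>N. step_size T N powr (- (2 * M + 1 - real l)))"
    and U: "quadrature_effort l Q U"
  shows "U \<in> O(\<lambda>N. step_size T N powr (- effort_exponent M l)) \<and>
     (\<lambda>N. global_error P d W J T \<alpha> N (Q N)) \<in> O(\<lambda>N. step_size T N powr M) \<and>
     (\<lambda>N. global_error P d W J T \<alpha> N (Q N)) \<in> O(\<lambda>N. U N powr (- M / effort_exponent M l))"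
proof -
  have ne: "\<alpha> \<noteq> []" "M > 0" using l M by auto
  have 1: "U \<in> O(\<lambda>N. step_size T N powr (- effort_exponent M l))"
    by (rule effort_bigo[OF T l(2) Q_bigo U])
  have 2: "(\<lambda>N. global_error P d W J T \<alpha> N (Q N)) \<in> O(\<lambda>N. step_size T N powr M)"
    by (rule global_error_bigo[OF T ne(1) \<alpha> Q err])
  have "(\<lambda>N. step_size T N powr M) \<in> O(\<lambda>N. U N powr (- M / effort_exponent M l))"
    using U by (intro step_size_bigo_effort[OF T ne(2) effort_exponent_pos[OF l(2) M] _ 1])
      (simp add: quadrature_effort_def)
  with 1 2 show ?thesis using landau_o.big_trans by blast
qed

text \<open>
  The choice \<open>Q \<approx> h\<close> to the power \<open>-(2 M + 1 - l)\<close> makes \<open>h\<^bsup>l\<^esup> / Q\<close> at most the square of \<open>h\<close> to the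
  power \<open>M + 1/2\<close>.  The exponent is negative because of \<open>M \<ge> l / 2\<close>, so that rounding up costs only a
  constant factor.
\<close>

lemma sufficient_subdivision:
  assumes T: "T > 0" and l: "length \<alpha> = l" "l \<ge> 2" and M: "M \<ge> real l / 2"
    and \<alpha>: "distinct \<alpha>" "set \<alpha> \<subseteq> {1..d}"
  obtains Q where "\<And>N. Q N \<ge> 1" "error_upto_order P d W J T \<alpha> Q M"
    "(\<lambda>N. real (Q N)) \<in> O(\<lambda>N. step_size T N powr (- (2 * M + 1 - real l)))"
proof -
  let ?g = "2 * M + 1 - real l"
  define Q where "Q N = Suc (nat \<lceil>step_size T N powr (- ?g)\<rceil>)" for N
  have Q1: "Q N \<ge> 1" for N by (simp add: Q_def)
  have ne: "\<alpha> \<noteq> []" using l by auto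
  have "error_upto_order P d W J T \<alpha> Q M"
    unfolding error_upto_order_def
  proof (intro exI conjI)
    show "sqrt (real l - 1) > 0" using l by simp
    show "\<forall>\<^sub>F N in sequentially. \<forall>n<N. L2_norm_rv P (local_error P d W J T \<alpha> N (Q N) n)
        \<le> sqrt (real l - 1) * step_size T N powr (M + 1/2)"
      using step_size_eventually[OF T zero_less_one]
    proof eventually_elim
      case (elim N)
      let ?h = "step_size T N"
      have pos: "0 < ?h powr (- ?g)" using elim by simp
      have QN: "?h powr (- ?g) \<le> real (Q N)" unfolding Q_def by linarith
      show ?case
      proof (intro allI impI)
        fix n assume n: "n < N"
        have "(L2_norm_rv P (local_error P d W J T \<alpha> N (Q N) n))\<^sup>2 \<le> (real l - 1) * ?h ^ l / real (Q N)"
          using quadrature_errors(1)[OF T ne \<alpha> Q1 n] l by simp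
        also have "\<dots> \<le> (real l - 1) * ?h ^ l / ?h powr (- ?g)"
          using QN pos elim l Q1[of N] by (intro divide_left_mono mult_pos_pos) auto
        also have "?h ^ l = ?h powr real l" using elim by (simp add: powr_realpow)
        also have "(real l - 1) * ?h powr real l / ?h powr (- ?g) = (real l - 1) * ?h powr (real l - (- ?g))"
          by (simp only: powr_diff times_divide_eq_right)
        also have "real l - (- ?g) = (M + 1/2) + (M + 1/2)" by simp
        also have "(real l - 1) * ?h powr ((M + 1/2) + (M + 1/2)) = (sqrt (real l - 1) * ?h powr (M + 1/2))\<^sup>2"
          unfolding powr_add using l by (simp add: power_mult_distrib power2_eq_square)
        finally show "L2_norm_rv P (local_error P d W J T \<alpha> N (Q N) n) \<le> sqrt (real l - 1) * ?h powr (M + 1/2)"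
          by (rule power2_le_imp_le) (use l in simp)
      qed
    qed
  qed
  moreover have "(\<lambda>N. real (Q N)) \<in> O(\<lambda>N. step_size T N powr (- ?g))"
  proof (rule bigoI[where c=3])
    show "\<forall>\<^sub>F N in sequentially. norm (real (Q N)) \<le> 3 * norm (step_size T N powr (- ?g))"
      using step_size_eventually[OF T zero_less_one]
    proof eventually_elim
      case (elim N)
      have "step_size T N powr 0 \<le> step_size T N powr (- ?g)"
        using elim M by (intro powr_mono') auto
      then have "1 \<le> step_size T N powr (- ?g)" using elim by simp
      moreover have "real (Q N) \<le> step_size T N powr (- ?g) + 2"
        using calculation unfolding Q_def by linarith
      ultimately show ?case by simp
    qed
  qed
  ultimately show thesis using that Q1 by blast
qed

text \<open>
  The upper bound of the local errors decreases in \<open>Q\<close>, so a lower bound of a local error bounds \<open>Q\<close>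
  from above.
\<close>

lemma necessary_subdivision:
  assumes T: "T > 0" and l: "length \<alpha> = l" "l \<ge> 2"
    and \<alpha>: "distinct \<alpha>" "set \<alpha> \<subseteq> {1..d}" and Q: "\<And>N. Q N \<ge> 1"
    and err: "error_of_order P d W J T \<alpha> Q M"
  shows "(\<lambda>N. real (Q N)) \<in> O(\<lambda>N. step_size T N powr (- (2 * M + 1 - real l)))"
proof -
  let ?g = "2 * M + 1 - real l"
  have ne: "\<alpha> \<noteq> []" using l by auto
  obtain c where c: "c > 0" "\<forall>\<^sub>F N in sequentially. \<forall>n<N.
        L2_norm_rv P (local_error P d W J T \<alpha> N (Q N) n) \<ge> c * step_size T N powr (M + 1/2)"
    using err unfolding error_of_order_def by blast
  show ?thesis
  proof (rule bigoI)
    show "\<forall>\<^sub>F N in sequentially. norm (real (Q N)) \<le> (real l - 1) / c\<^sup>2 * norm (step_size T N powr (- ?g))"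
      using c(2) step_size_eventually[OF T zero_less_one]
    proof eventually_elim
      case (elim N)
      let ?h = "step_size T N"
      have Qpos: "0 < real (Q N)" using Q[of N] by simp
      have "(c * ?h powr (M + 1/2))\<^sup>2 \<le> (L2_norm_rv P (local_error P d W J T \<alpha> N (Q N) 0))\<^sup>2"
        using elim c(1) by (intro power_mono) auto
      also have "\<dots> \<le> (real l - 1) * ?h ^ l / real (Q N)"
        using quadrature_errors(1)[OF T ne \<alpha> Q, of 0 N] elim l by simp
      also have "?h ^ l = ?h powr real l" using elim by (simp add: powr_realpow)
      finally have "(c * ?h powr (M + 1/2))\<^sup>2 * real (Q N) \<le> (real l - 1) * ?h powr real l"
        using Qpos by (simp add: field_simps)
      moreover have "(c * ?h powr (M + 1/2))\<^sup>2 = c\<^sup>2 * ?h powr (2 * M + 1)"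
        by (simp add: power_mult_distrib power2_eq_square powr_add[symmetric])
      moreover have "?h powr real l = ?h powr (2 * M + 1) * ?h powr (- ?g)"
        by (simp add: powr_add[symmetric])
      ultimately have "?h powr (2 * M + 1) * (c\<^sup>2 * real (Q N)) \<le> ?h powr (2 * M + 1) * ((real l - 1) * ?h powr (- ?g))"
        by (simp add: mult_ac)
      then have "c\<^sup>2 * real (Q N) \<le> (real l - 1) * ?h powr (- ?g)"
        using elim by (subst (asm) mult_le_cancel_left_pos) auto
      then show ?case using c(1) by (simp add: field_simps)
    qed
  qed
qed

end

theorem lemma7p1:
  fixes P :: "'w measure" and d :: nat
    and W :: "nat \<Rightarrow> real \<Rightarrow> 'w \<Rightarrow> real"
    and J :: "nat list \<Rightarrow> real \<Rightarrow> real \<Rightarrow> 'w \<Rightarrow> real"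
    and T M :: real and \<alpha> :: "nat list" and l :: nat
  assumes "wiener_process P d W"
    and "multiple_stratonovich P d W J"
    and "T > 0"
    and "length \<alpha> = l" and "l \<ge> 2" and "M \<ge> real l / 2"
    and "distinct \<alpha>" and "set \<alpha> \<subseteq> {1..d}"
  shows
    "(\<exists>Q. (\<forall>N. Q N \<ge> 1) \<and> error_upto_order P d W J T \<alpha> Q M \<and>
        (\<forall>U. quadrature_effort l Q U \<longrightarrow>
           U \<in> O(\<lambda>N. step_size T N powr (- effort_exponent M l)) \<and>
           (\<lambda>N. global_error P d W J T \<alpha> N (Q N)) \<in> O(\<lambda>N. step_size T N powr M) \<and>
           (\<lambda>N. global_error P d W J T \<alpha> N (Q N)) \<in> O(\<lambda>N. U N powr (- M / effort_exponent M l)))) \<and>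
     (\<forall>Q. (\<forall>N. Q N \<ge> 1) \<and> error_of_order P d W J T \<alpha> Q M \<longrightarrow>
        (\<forall>U. quadrature_effort l Q U \<longrightarrow>
           U \<in> O(\<lambda>N. step_size T N powr (- effort_exponent M l)) \<and>
           (\<lambda>N. global_error P d W J T \<alpha> N (Q N)) \<in> O(\<lambda>N. step_size T N powr M) \<and>
           (\<lambda>N. global_error P d W J T \<alpha> N (Q N)) \<in> O(\<lambda>N. U N powr (- M / effort_exponent M l))))"
proof -
  interpret prob_space P using assms(1) by (simp add: wiener_process_def)
  interpret stratonovich P d W J by unfold_locales (fact assms)+
  note main = effort_and_error[OF assms(3-8)]
  obtain Q where Q: "\<And>N. Q N \<ge> 1" "error_upto_order P d W J T \<alpha> Q M"
    "(\<lambda>N. real (Q N)) \<in> O(\<lambda>N. step_size T N powr (- (2 * M + 1 - real l)))"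
    using sufficient_subdivision[OF assms(3-8)] by blast
  show ?thesis
  proof (intro conjI[OF exI[of _ Q]] conjI[OF _ conjI] allI impI)
    show "Q N \<ge> 1" for N by (rule Q)
    show "error_upto_order P d W J T \<alpha> Q M" by (rule Q)
  next
    fix U assume "quadrature_effort l Q U"
    note * = main[OF Q this]
    show "U \<in> O(\<lambda>N. step_size T N powr (- effort_exponent M l))"
      "(\<lambda>N. global_error P d W J T \<alpha> N (Q N)) \<in> O(\<lambda>N. step_size T N powr M)"
      "(\<lambda>N. global_error P d W J T \<alpha> N (Q N)) \<in> O(\<lambda>N. U N powr (- M / effort_exponent M l))"
      using * by auto
  next
    fix Q :: "nat \<Rightarrow> nat" and U assume Q: "(\<forall>N. Q N \<ge> 1) \<and> error_of_order P d W J T \<alpha> Q M"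
      and U: "quadrature_effort l Q U"
    then have Q1: "\<And>N. Q N \<ge> 1" and err: "error_of_order P d W J T \<alpha> Q M" by auto
    have upto: "error_upto_order P d W J T \<alpha> Q M" using err by (simp add: error_of_order_def)
    note * = main[OF Q1 upto necessary_subdivision[OF assms(3-5,7,8) Q1 err] U]
    show "U \<in> O(\<lambda>N. step_size T N powr (- effort_exponent M l))"
      "(\<lambda>N. global_error P d W J T \<alpha> N (Q N)) \<in> O(\<lambda>N. step_size T N powr M)"
      "(\<lambda>N. global_error P d W J T \<alpha> N (Q N)) \<in> O(\<lambda>N. U N powr (- M / effort_exponent M l))"
      using * by auto
  qed
qed

end
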